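(* Let $\mathbb{K}\in\{\mathbb{R},\mathbb{C}\}$ and let $\mathbf{K}\subset\mathbb{R}$ be the Cantor set. Suppose that $(x_n)$ is a sequence in $\mathbb{R}\setminus\mathbf{K}$ with infinitely many distinct terms which converges to a point $L\in\mathbb{R}$. Let $X:=\mathbf{K}\cup\{x_n:n\in\mathbb{N}\}\cup\{L\}$, with the topology induced from $\mathbb{R}$. Then: (1) If $L\notin\mathbf{K}$, then for each $n\in\mathbb{N}\cup\{\infty\}$ there exists an isometric shift of type $\mathrm{I}_0$ on $C(X)$ which is $n$-generated. (2) If $L\in\mathbf{K}$, then there exists an isometric shift of type $\mathrm{I}_0$ on $C(X)$ which also satisfies the additional condition that $a\equiv1$, where $a$ is the weight function in its type $\mathrm{I}$ representation.
   Context: For compact Hausdorff $X$, $C(X)$ is the Banach space of $\mathbb{K}$-valued continuous functions on $X$ with the supremum norm. An isometric shift on a Banach space $E$ is a linear isometry $T:E\to E$ with $T(E)$ of codimension $1$ and $\bigcap_{n\ge1}T^n(E)=\{0\}$. An isometric shift $T$ on $C(X)$ is of type $\mathrm{I}$ if there are an isolated point $p\in X$, a homeomorphism $\phi$ from $X\setminus\{p\}$ onto $X$ and a function $a\in C(X\setminus\{p\})$ (the weight) with $|a|\equiv1$ such that $(Tf)(x)=a(x)f(\phi(x))$ for all $x\ne p$ and $f\in C(X)$. It is of type $\mathrm{II}$ if there are a continuous surjection $\phi:X\to X$ and $a\in C(X)$, $|a|\equiv1$, with $(Tf)(x)=a(x)f(\phi(x))$ for all $x\in X$ and $f\in C(X)$.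 It is of type $\mathrm{I}_0$ if it is of type $\mathrm{I}$ and not of type $\mathrm{II}$. For $T$ of type $\mathrm{I}$, with $p\in X$ an isolated point, $\phi$ a homeomorphism from $X\setminus\{p\}$ onto $X$ and $a\in C(X\setminus\{p\})$, $|a|\equiv1$, such that $(Tf)(x)=a(x)f(\phi(x))$ for all $x\ne p$ and $f\in C(X)$, put $\mathbf{1}:=p$ and let $\mathbf{n+1}$ be the point with $\phi(\mathbf{n+1})=\mathbf{n}$; set $\mathcal{N}:=\{\mathbf{1},\mathbf{2},\dots\}$ (a set of isolated points). Then $\phi$ restricts to a homeomorphism of $X\setminus\mathrm{cl}_X(\mathcal{N})$ onto itself. If $\mathcal{N}$ is not dense in $X$, then for $n\in\mathbb{N}$, $T$ is $n$-generated if $n$ is the least number for which there are $x_1,\dots,x_n\in X\setminus\mathrm{cl}_X(\mathcal{N})$ such that $\{\phi^k(x_i):k\in\mathbb{Z},\,1\le i\le n\}$ is dense in $X\setminus\mathrm{cl}_X(\mathcal{N})$; $T$ is $\infty$-generated if it is not $n$-generated for any $n\in\mathbb{N}$. *)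

theory Defs
  imports "HOL-Analysis.Analysis"
begin

(* Middle-thirds construction. *)
primrec cantor_stage :: "nat \<Rightarrow> real set" where
  "cantor_stage 0 = {0..1}"
| "cantor_stage (Suc n) =
     (\<lambda>t. t / 3) ` cantor_stage n \<union> (\<lambda>t. 2 / 3 + t / 3) ` cantor_stage n"

definition cantor_set :: "real set" where
  "cantor_set = (\<Inter>n. cantor_stage n)"

(* C(X) for a subspace X of an ambient space.  Continuous functions on X are represented by total
   functions that vanish outside X, so that equality in C(X) is equality in HOL and the vector
   space operations are pointwise.  The definitions below are meant for compact Hausdorff X and
   for scalar fields 'k = real or 'k = complex. *)
definition cont_funs :: "'a::t2_space set \<Rightarrow> ('a \<Rightarrow> 'k::real_normed_field) set" where
  "cont_funs X = {f. continuous_on X f \<and> (\<forall>x. x \<notin> X \<longrightarrow> f x = 0)}"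

definition sup_norm :: "'a::t2_space set \<Rightarrow> ('a \<Rightarrow> 'k::real_normed_field) \<Rightarrow> real" where
  "sup_norm X f = (SUP x\<in>X. norm (f x))"

(* T is total on the ambient function type; only its restriction to C(X) matters. *)
definition linear_isometry ::
    "'a::t2_space set \<Rightarrow> (('a \<Rightarrow> 'k::real_normed_field) \<Rightarrow> ('a \<Rightarrow> 'k)) \<Rightarrow> bool" where
  "linear_isometry X T \<longleftrightarrow>
     (\<forall>f\<in>cont_funs X. T f \<in> cont_funs X) \<and>
     (\<forall>f\<in>cont_funs X. \<forall>g\<in>cont_funs X. T (\<lambda>x. f x + g x) = (\<lambda>x. T f x + T g x)) \<and>
     (\<forall>c. \<forall>f\<in>cont_funs X. T (\<lambda>x. c * f x) = (\<lambda>x. c * T f x)) \<and>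
     (\<forall>f\<in>cont_funs X. sup_norm X (T f) = sup_norm X f)"

(* The quotient of C(X) by the subspace W is one-dimensional: it is spanned by the class of a
   single g, and that class is nonzero. *)
definition codim_one :: "'a::t2_space set \<Rightarrow> ('a \<Rightarrow> 'k::real_normed_field) set \<Rightarrow> bool" where
  "codim_one X W \<longleftrightarrow> W \<subseteq> cont_funs X \<and>
     (\<exists>g\<in>cont_funs X. g \<notin> W \<and> (\<forall>f\<in>cont_funs X. \<exists>c. (\<lambda>x. f x - c * g x) \<in> W))"

definition isometric_shift ::
    "'a::t2_space set \<Rightarrow> (('a \<Rightarrow> 'k::real_normed_field) \<Rightarrow> ('a \<Rightarrow> 'k)) \<Rightarrow> bool" where
  "isometric_shift X T \<longleftrightarrow>
     linear_isometry X T \<and>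
     codim_one X (T ` cont_funs X) \<and>
     (\<Inter>n\<in>{1..}. (T ^^ n) ` cont_funs X) = {\<lambda>x. 0}"

definition type_I_rep ::
    "'a::t2_space set \<Rightarrow> (('a \<Rightarrow> 'k::real_normed_field) \<Rightarrow> ('a \<Rightarrow> 'k)) \<Rightarrow>
     'a \<Rightarrow> ('a \<Rightarrow> 'a) \<Rightarrow> ('a \<Rightarrow> 'k) \<Rightarrow> bool" where
  "type_I_rep X T p \<phi> a \<longleftrightarrow>
     p isolated_in X \<and>
     (\<exists>\<psi>. homeomorphism (X - {p}) X \<phi> \<psi>) \<and>
     continuous_on (X - {p}) a \<and> (\<forall>x\<in>X - {p}. norm (a x) = 1) \<and>
     (\<forall>f\<in>cont_funs X. \<forall>x\<in>X - {p}. T f x = a x * f (\<phi> x))"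

definition type_I ::
    "'a::t2_space set \<Rightarrow> (('a \<Rightarrow> 'k::real_normed_field) \<Rightarrow> ('a \<Rightarrow> 'k)) \<Rightarrow> bool" where
  "type_I X T \<longleftrightarrow> (\<exists>p \<phi> a. type_I_rep X T p \<phi> a)"

definition type_II ::
    "'a::t2_space set \<Rightarrow> (('a \<Rightarrow> 'k::real_normed_field) \<Rightarrow> ('a \<Rightarrow> 'k)) \<Rightarrow> bool" where
  "type_II X T \<longleftrightarrow>
     (\<exists>\<phi> a. continuous_on X \<phi> \<and> \<phi> ` X = X \<and>
        continuous_on X a \<and> (\<forall>x\<in>X. norm (a x) = 1) \<and>
        (\<forall>f\<in>cont_funs X. \<forall>x\<in>X. T f x = a x * f (\<phi> x)))"

definition type_I0 ::
    "'a::t2_space set \<Rightarrow> (('a \<Rightarrow> 'k::real_normed_field) \<Rightarrow> ('a \<Rightarrow> 'k)) \<Rightarrow> bool" where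
  "type_I0 X T \<longleftrightarrow> type_I X T \<and> \<not> type_II X T"

(* The set {p, \<phi>^(-1) p, \<phi>^(-2) p, ...}. *)
definition shift_points :: "'a::t2_space set \<Rightarrow> 'a \<Rightarrow> ('a \<Rightarrow> 'a) \<Rightarrow> 'a set" where
  "shift_points X p \<phi> = range (\<lambda>n. (inv_into (X - {p}) \<phi> ^^ n) p)"

(* X is closed in its Hausdorff ambient space, so removing the ambient closure is the same as
   removing the closure in X. *)
definition core_set :: "'a::t2_space set \<Rightarrow> 'a \<Rightarrow> ('a \<Rightarrow> 'a) \<Rightarrow> 'a set" where
  "core_set X p \<phi> = X - closure (shift_points X p \<phi>)"

(* Integer iterates of a bijection \<phi> of Y onto itself. *)
definition int_iter :: "'a set \<Rightarrow> ('a \<Rightarrow> 'a) \<Rightarrow> int \<Rightarrow> 'a \<Rightarrow> 'a" where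
  "int_iter Y \<phi> k =
     (if k \<ge> 0 then \<phi> ^^ nat k else inv_into Y \<phi> ^^ nat (- k))"

definition has_generators :: "'a::t2_space set \<Rightarrow> 'a \<Rightarrow> ('a \<Rightarrow> 'a) \<Rightarrow> nat \<Rightarrow> bool" where
  "has_generators X p \<phi> n \<longleftrightarrow>
     (let Y = core_set X p \<phi> in
      \<exists>x :: nat \<Rightarrow> 'a. (\<forall>i\<in>{1..n}. x i \<in> Y) \<and>
        Y \<subseteq> closure {int_iter Y \<phi> k (x i) | k i. i \<in> {1..n}})"

definition least_generators :: "'a::t2_space set \<Rightarrow> 'a \<Rightarrow> ('a \<Rightarrow> 'a) \<Rightarrow> nat \<Rightarrow> bool" where
  "least_generators X p \<phi> n \<longleftrightarrow>
     has_generators X p \<phi> n \<and> (\<forall>m<n. \<not> has_generators X p \<phi> m)"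

(* The representing data (p, \<phi>, a on X - {p}) of a type I_0 shift are unique up to the values of
   \<phi> and a outside X - {p}: two representations with different p would make T of type II.  So
   the choice of representation is immaterial.  Both the finite and the infinite case
   presuppose that the set of shift points is not dense. *)
definition shift_generated ::
    "'a::t2_space set \<Rightarrow> (('a \<Rightarrow> 'k::real_normed_field) \<Rightarrow> ('a \<Rightarrow> 'k)) \<Rightarrow> enat \<Rightarrow> bool" where
  "shift_generated X T n \<longleftrightarrow>
     (\<exists>p \<phi> a. type_I_rep X T p \<phi> a \<and>
        \<not> X \<subseteq> closure (shift_points X p \<phi>) \<and>
        (case n of enat m \<Rightarrow> least_generators X p \<phi> m
                 | \<infinity> \<Rightarrow> (\<forall>m. \<not> least_generators X p \<phi> m)))"

end

theory Submission
  imports Defs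
begin

text \<open>Write \<open>X\<close> as the union of the Cantor set and of a sequence \<open>e\<close> of isolated points converging to
  \<open>L\<close>. The homeomorphism \<open>\<phi>\<close> moves \<open>e (n + 1)\<close> to \<open>e n\<close> and acts on the Cantor set, viewed as
  \<open>U \<times> {0,1}^\<int>\<close>, as the shift on the second factor, while \<open>(T f) (e 0) = \<Lambda> f\<close> for a functional \<open>\<Lambda>\<close> of norm
  at most \<open>1/2\<close> supported on the Cantor set. The norm bound excludes type II. A function in all the ranges
  has the value \<open>\<Lambda> (R^(n+1) f)\<close> at \<open>e n\<close>, where \<open>R\<close> is the inverse of the weighted composition, so these
  numbers converge to \<open>f L\<close>, and \<open>\<Lambda>\<close> has to be chosen such that this forces \<open>f = 0\<close>.

  If \<open>L\<close> is outside the Cantor set, take \<open>U\<close> with \<open>n\<close> points, or a Cantor set for \<open>n = \<infinity>\<close>: every fibre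
  is transitive and invariant, so \<open>card U\<close> generators are needed. The weight is \<open>(-1)^(y 0)\<close>, and \<open>\<Lambda>\<close> is a
  weighted sum of evaluations at points in a dense sequence of fibres whose backward orbits, together with the
  accumulated signs, are jointly dense; convergence then makes a sum of independent odd functions constant,
  hence zero.

  If \<open>L\<close> is in the Cantor set, let \<open>U\<close> be a point, the weight trivial and \<open>\<Lambda> f = f q / 2\<close> with \<open>q\<close> of
  dense backward orbit, with \<open>L\<close> the fixed point of the shift: convergence to \<open>f L\<close> makes \<open>f\<close>
  constant with \<open>f / 2 = f\<close>.\<close>

subsection \<open>Coding the Cantor set\<close>

text \<open>Weierstrass M-test; it gives continuity of both the ternary coding and
  \<open>orbit_sum\<close>.\<close>

lemma continuous_on_suminf:
  fixes f :: "nat \<Rightarrow> 'a::topological_space \<Rightarrow> 'b::banach"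
  assumes "\<And>i. continuous_on A (f i)" "\<And>i x. x \<in> A \<Longrightarrow> norm (f i x) \<le> M i" "summable M"
  shows "continuous_on A (\<lambda>x. \<Sum>i. f i x)"
proof -
  have "uniform_limit A (\<lambda>n x. \<Sum>i<n. f i x) (\<lambda>x. \<Sum>i. f i x) sequentially"
    using assms(2,3) by (rule Weierstrass_m_test)
  then show ?thesis
    by (rule uniform_limit_theorem[rotated]) (auto intro!: always_eventually continuous_on_sum assms(1))
qed

text \<open>Tychonoff's theorem for a power of the two-point space.\<close>

lemma compact_UNIV_bool_fun: "compact (UNIV :: ('a \<Rightarrow> bool) set)"
proof -
  have "compact (UNIV :: bool set)"
    by (simp add: finite_imp_compact)
  then have "compact_space (euclidean :: bool topology)"
    by (simp add: compact_space_def)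
  then have "compact_space (product_topology (\<lambda>_::'a. euclidean :: bool topology) UNIV)"
    by (simp add: compact_space_product_topology)
  then show ?thesis
    by (simp add: euclidean_product_topology compact_space_def)
qed

lemma continuous_on_of_coordinate:
  fixes h :: "bool \<Rightarrow> 'b::topological_space"
  shows "continuous_on S (\<lambda>b::'a \<Rightarrow> bool. h (b i))"
proof -
  have "continuous_on UNIV h" by simp
  moreover have "continuous_on S (\<lambda>b::'a \<Rightarrow> bool. b i)"
    using continuous_on_product_then_coordinatewise[OF continuous_on_id, of S i] by simp
  ultimately show ?thesis
    using continuous_on_compose2[of UNIV h S "\<lambda>b. b i"] by simp
qed

text \<open>The ternary expansion with digits 0 and 2.\<close>

definition cantor_map :: "(nat \<Rightarrow> bool) \<Rightarrow> real" where
  "cantor_map b = (\<Sum>i. (if b i then 2 else 0) / 3 ^ Suc i)"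

lemma cantor_map_term_le: "norm ((if b i then 2 else 0) / 3 ^ Suc i :: real) \<le> 2 / 3 * (1 / 3) ^ i"
  by (auto simp: field_simps)

lemma summable_cantor_bound: "summable (\<lambda>i. 2 / 3 * (1 / 3 :: real) ^ i)"
  by (intro summable_mult summable_geometric) auto

lemma summable_cantor_map: "summable (\<lambda>i. (if b i then 2 else 0) / 3 ^ Suc i :: real)"
  using cantor_map_term_le by (rule summable_comparison_test'[OF summable_cantor_bound])

lemma continuous_on_cantor_map: "continuous_on S cantor_map"
proof -
  have "continuous_on S (\<lambda>b::nat \<Rightarrow> bool. \<Sum>i. (if b i then 2 else 0) / 3 ^ Suc i :: real)"
    by (rule continuous_on_suminf[OF continuous_on_of_coordinate cantor_map_term_le summable_cantor_bound])
  then show ?thesis unfolding cantor_map_def[abs_def] .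
qed

lemma cantor_map_rec:
  "cantor_map b = (if b 0 then 2 / 3 else 0) + cantor_map (\<lambda>i. b (Suc i)) / 3"
proof -
  have "cantor_map b = (if b 0 then 2 / 3 else 0) + (\<Sum>i. (if b (Suc i) then 2 else 0) / 3 ^ Suc (Suc i))"
    unfolding cantor_map_def using suminf_split_head[OF summable_cantor_map[of b]] by simp
  also have "(\<Sum>i. (if b (Suc i) then 2 else 0) / 3 ^ Suc (Suc i)) = cantor_map (\<lambda>i. b (Suc i)) / 3"
    unfolding cantor_map_def
    using suminf_divide[OF summable_cantor_map[of "\<lambda>i. b (Suc i)"], of 3] by (simp add: mult_ac)
  finally show ?thesis .
qed

lemma cantor_map_bounds: "0 \<le> cantor_map b" "cantor_map b \<le> 1"
proof -
  show "0 \<le> cantor_map b"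
    unfolding cantor_map_def by (rule suminf_nonneg[OF summable_cantor_map]) simp
  have "cantor_map b \<le> (\<Sum>i. 2 / 3 * (1 / 3) ^ i)"
    unfolding cantor_map_def
    by (intro suminf_le summable_cantor_map summable_cantor_bound order.trans[OF _ cantor_map_term_le[of b]]) simp
  also have "\<dots> = 1"
    using suminf_mult[of "power (1 / 3 :: real)" "2 / 3"] by (simp add: suminf_geometric summable_geometric)
  finally show "cantor_map b \<le> 1" .
qed

text \<open>The digits after the first contribute at most 1/3, less than the 2/3 of a first digit 2;
  so the first digit and then the tail are determined.\<close>

lemma inj_cantor_map: "inj cantor_map"
proof -
  have "b n = c n" if "cantor_map b = cantor_map c" for b c n
    using that
  proof (induction n arbitrary: b c)
    case 0
    then show ?case
      using cantor_map_rec[of b] cantor_map_rec[of c] cantor_map_bounds[of "\<lambda>i. b (Suc i)"]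
        cantor_map_bounds[of "\<lambda>i. c (Suc i)"] by (auto split: if_splits)
  next
    case (Suc n)
    have "cantor_map (\<lambda>i. b (Suc i)) = cantor_map (\<lambda>i. c (Suc i))"
      using Suc.prems cantor_map_rec[of b] cantor_map_rec[of c] cantor_map_bounds[of "\<lambda>i. b (Suc i)"]
        cantor_map_bounds[of "\<lambda>i. c (Suc i)"] by (auto split: if_splits)
    then show ?case using Suc.IH by blast
  qed
  then show ?thesis by (intro injI ext)
qed

lemma cantor_map_in_stage: "cantor_map b \<in> cantor_stage n"
proof (induction n arbitrary: b)
  case 0
  then show ?case by (simp add: cantor_map_bounds)
next
  case (Suc n)
  then show ?case
    by (subst cantor_map_rec) auto
qed

lemma cantor_stage_subset: "cantor_stage n \<subseteq> {0..1}"
  by (induction n) (auto simp: subset_eq)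

text \<open>Digit extraction. The two contracted copies of a stage lie in [0,1/3] and [2/3,1], so
  comparing \<open>t\<close> with 1/3 tells, for all stages alike, which contraction to
  invert.\<close>

lemma cantor_set_cases:
  assumes "t \<in> cantor_set"
  obtains b t' where "t' \<in> cantor_set" "t = (if b then 2 / 3 else 0) + t' / 3"
proof -
  define t' where "t' = (if t \<le> 1 / 3 then 3 * t else 3 * t - 2)"
  have "t' \<in> cantor_stage n" for n
  proof -
    have "t \<in> cantor_stage (Suc n)" using assms unfolding cantor_set_def by blast
    then show ?thesis
      using cantor_stage_subset[of n] by (auto simp: t'_def subset_eq field_simps)
  qed
  then have "t' \<in> cantor_set" by (simp add: cantor_set_def)
  then show ?thesis
    by (rule that[of _ "\<not> t \<le> 1 / 3"]) (simp add: t'_def field_simps)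
qed

lemma range_cantor_map: "range cantor_map = cantor_set"
proof
  show "range cantor_map \<subseteq> cantor_set"
    using cantor_map_in_stage by (auto simp: cantor_set_def)
  show "cantor_set \<subseteq> range cantor_map"
  proof
    fix t assume "t \<in> cantor_set"
    obtain B S where step: "\<And>t. t \<in> cantor_set \<Longrightarrow> S t \<in> cantor_set \<and> t = (if B t then 2 / 3 else 0) + S t / 3"
      by (metis cantor_set_cases)
    define b where "b = (\<lambda>n. B ((S ^^ n) t))"
    have mem: "(S ^^ n) t \<in> cantor_set" for n
      using \<open>t \<in> cantor_set\<close> step by (induction n) auto
    \<comment> \<open>The remainder after \<open>n\<close> extracted digits is a point of [0,1]
      scaled by 3^(-n), hence tends to 0.\<close>
    have diff: "t - (\<Sum>i<n. (if b i then 2 else 0) / 3 ^ Suc i) = (S ^^ n) t / 3 ^ n" for n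
    proof (induction n)
      case (Suc n)
      have "(S ^^ n) t = (if b n then 2 / 3 else 0) + (S ^^ Suc n) t / 3"
        using step[OF mem[of n]] by (simp add: b_def)
      then have "(S ^^ n) t / 3 ^ n = (if b n then 2 else 0) / 3 ^ Suc n + (S ^^ Suc n) t / 3 ^ Suc n"
        by (simp add: field_simps)
      with Suc show ?case by simp
    qed simp
    have "(\<lambda>n. (S ^^ n) t / 3 ^ n) \<longlonglongrightarrow> 0"
    proof (rule Lim_null_comparison)
      have "\<bar>(S ^^ n) t\<bar> \<le> 1" for n
        using mem[of n] cantor_stage_subset[of 0] unfolding cantor_set_def by (auto simp del: cantor_stage.simps)
      then show "\<forall>\<^sub>F n in sequentially. norm ((S ^^ n) t / 3 ^ n) \<le> (1 / 3) ^ n"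
        by (auto simp: power_divide intro!: always_eventually divide_right_mono)
      show "(\<lambda>n. (1 / 3 :: real) ^ n) \<longlonglongrightarrow> 0" by (rule LIMSEQ_power_zero) simp
    qed
    then have "(\<lambda>n. t - (\<Sum>i<n. (if b i then 2 else 0) / 3 ^ Suc i)) \<longlonglongrightarrow> 0"
      by (simp only: diff)
    then have "(\<lambda>n. t - (t - (\<Sum>i<n. (if b i then 2 else 0) / 3 ^ Suc i))) \<longlonglongrightarrow> t - 0"
      by (intro tendsto_intros)
    then have "(\<lambda>i. (if b i then 2 else 0) / 3 ^ Suc i) sums t"
      by (simp add: sums_def)
    then have "t = cantor_map b"
      unfolding cantor_map_def by (rule sums_unique)
    then show "t \<in> range cantor_map" by blast
  qed
qed

subsection \<open>Generic sequences and the shift\<close>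

lemma tendsto_coordinatewise:
  fixes f :: "'c \<Rightarrow> 'a \<Rightarrow> 'b::topological_space"
  assumes "\<And>i. ((\<lambda>c. f c i) \<longlongrightarrow> l i) F"
  shows "(f \<longlongrightarrow> l) F"
proof -
  have "limitin (product_topology (\<lambda>_. euclidean) UNIV) f l F"
    using assms by (simp add: limitin_componentwise)
  then show ?thesis
    by (simp add: euclidean_product_topology)
qed

text \<open>One and the same \<open>n\<close> serves all sequences with index up to
  \<open>r\<close>; this joint genericity makes the summands of \<open>orbit_sum\<close> independent
  of each other.\<close>

lemma generic_sequence_exists:
  obtains s :: "nat \<Rightarrow> int \<Rightarrow> bool"
  where "\<And>Z r. \<exists>n\<ge>r. \<forall>i j. i \<le> r \<longrightarrow> \<bar>j\<bar> \<le> int r \<longrightarrow> s i (j - int n) = Z i j"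
proof -
  \<comment> \<open>The pattern coded by \<^term>\<open>m\<close> is written on the window of radius \<^term>\<open>m\<close> around
    \<^term>\<open>- c m\<close>; the windows are disjoint and every pattern recurs.\<close>
  define t :: "nat \<Rightarrow> (nat \<times> int) list" where "t m = from_nat (fst (prod_decode m))" for m
  define c where "c m = (m + 1) * (m + 1)" for m :: nat
  define s where "s i k \<longleftrightarrow> (\<exists>m. \<bar>k + int (c m)\<bar> \<le> int m \<and> (i, k + int (c m)) \<in> set (t m))" for i k
  have gap: "c m + m + m' < c m'" if lt: "m < m'" for m m'
  proof -
    obtain d where "m' = Suc (m + d)"
      using less_imp_Suc_add[OF lt] by blast
    then have "c m' = c m + m + m' + (2 + 3 * d + 2 * m * d + d * d)"
      by (simp add: c_def algebra_simps)
    then show ?thesis by linarith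
  qed
  have cge: "m \<le> c m" for m by (simp add: c_def)
  have uniq: "m = m'" if "\<bar>k + int (c m)\<bar> \<le> int m" "\<bar>k + int (c m')\<bar> \<le> int m'" for k m m'
  proof (rule linorder_cases[of m m'])
    assume "m < m'"
    from gap[OF this] that show ?thesis by linarith
  next
    assume "m' < m"
    from gap[OF this] that show ?thesis by linarith
  qed
  have "\<exists>n\<ge>r. \<forall>i j. i \<le> r \<longrightarrow> \<bar>j\<bar> \<le> int r \<longrightarrow> s i (j - int n) = Z i j" for Z :: "nat \<Rightarrow> int \<Rightarrow> bool" and r
  proof -
    have "finite ({(i, j). i \<le> r \<and> \<bar>j\<bar> \<le> int r \<and> Z i j})"
      by (rule finite_subset[of _ "{..r} \<times> {- int r..int r}"]) auto
    then obtain l where l: "set l = {(i, j). i \<le> r \<and> \<bar>j\<bar> \<le> int r \<and> Z i j}"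
      using finite_list by blast
    \<comment> \<open>The first component codes the pattern. The second makes \<open>m\<close> at
      least \<open>r\<close>, so that the window of radius \<open>m\<close> contains all positions
      up to \<open>r\<close>.\<close>
    define m where "m = prod_encode (to_nat l, r)"
    have tm: "t m = l" by (simp add: t_def m_def)
    have mr: "r \<le> m" by (simp add: m_def le_prod_encode_2)
    have "s i (j - int (c m)) = Z i j" if "i \<le> r" "\<bar>j\<bar> \<le> int r" for i j
    proof -
      have "s i (j - int (c m)) \<longleftrightarrow> (i, j) \<in> set (t m)"
      proof
        assume "s i (j - int (c m))"
        then obtain m' where m': "\<bar>j - int (c m) + int (c m')\<bar> \<le> int m'" "(i, j - int (c m) + int (c m')) \<in> set (t m')"
          unfolding s_def by blast
        moreover have "m' = m" using m'(1) by (rule uniq) (use that mr in auto)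
        ultimately show "(i, j) \<in> set (t m)" by simp
      next
        assume "(i, j) \<in> set (t m)"
        then show "s i (j - int (c m))"
          unfolding s_def using that mr by (intro exI[of _ m]) auto
      qed
      then show ?thesis using that by (simp add: tm l)
    qed
    then show ?thesis using mr cge[of m] by (intro exI[of _ "c m"]) auto
  qed
  then show ?thesis by (rule that)
qed

definition shift :: "int \<Rightarrow> (int \<Rightarrow> bool) \<Rightarrow> int \<Rightarrow> bool" where
  "shift k y = (\<lambda>j. y (j + k))"

text \<open>The backward orbit of \<open>s\<close> in a countable power of the full shift
  accumulates at every point. The times tend to infinity, so limits along the whole orbit can be
  evaluated along them.\<close>

definition generic :: "(nat \<Rightarrow> int \<Rightarrow> bool) \<Rightarrow> bool" where
  "generic s \<longleftrightarrow>
    (\<forall>Z. \<exists>n. filterlim n at_top sequentially \<and>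
      (\<forall>i. (\<lambda>r. shift (- int (n r)) (s i)) \<longlonglongrightarrow> Z i))"

lemma generic_exists: "\<exists>s. generic s"
proof -
  obtain s :: "nat \<Rightarrow> int \<Rightarrow> bool"
    where s: "\<And>Z r. \<exists>n\<ge>r. \<forall>i j. i \<le> r \<longrightarrow> \<bar>j\<bar> \<le> int r \<longrightarrow> s i (j - int n) = Z i j"
    using generic_sequence_exists by blast
  have "generic s"
    unfolding generic_def
  proof
    fix Z :: "nat \<Rightarrow> int \<Rightarrow> bool"
    obtain n where n: "\<And>r. n r \<ge> r" "\<And>r i j. i \<le> r \<Longrightarrow> \<bar>j\<bar> \<le> int r \<Longrightarrow> s i (j - int (n r)) = Z i j"
      using s[where Z = Z] by metis
    have "filterlim n at_top sequentially"
      using n(1) by (intro filterlim_at_top_mono[OF filterlim_ident]) auto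
    moreover have "(\<lambda>r. shift (- int (n r)) (s i)) \<longlonglongrightarrow> Z i" for i
    proof (rule tendsto_coordinatewise)
      fix j
      have "\<forall>\<^sub>F r in sequentially. shift (- int (n r)) (s i) j = Z i j"
        using eventually_ge_at_top[of "max i (nat \<bar>j\<bar>)"]
        proof eventually_elim
          case (elim r)
          then have "s i (j - int (n r)) = Z i j" by (intro n(2)) auto
          then show ?case by (simp add: shift_def)
        qed
      then show "(\<lambda>r. shift (- int (n r)) (s i) j) \<longlonglongrightarrow> Z i j"
        by (rule tendsto_eventually)
    qed
    ultimately show "\<exists>n. filterlim n at_top sequentially \<and> (\<forall>i. (\<lambda>r. shift (- int (n r)) (s i)) \<longlonglongrightarrow> Z i)"
      by blast
  qed
  then show ?thesis by blast
qed

lemma shift_0 [simp]: "shift 0 y = y"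
  by (simp add: shift_def)

lemma shift_shift [simp]: "shift k (shift l y) = shift (k + l) y"
  by (simp add: shift_def ac_simps)

lemma continuous_on_shift:
  "continuous_on S f \<Longrightarrow> continuous_on S (\<lambda>x. shift k (f x))"
  unfolding shift_def
  by (rule continuous_on_coordinatewise_then_product, rule continuous_on_product_then_coordinatewise)

text \<open>Passing to \<^term>\<open>diff_seq s\<close> turns the cocycle given by the weight \<open>(-1)^(y 0)\<close> over the shift into
  a plain sign: a function twisted by the weight lifts to an odd function of \<^term>\<open>s\<close>.\<close>
definition diff_seq :: "(int \<Rightarrow> bool) \<Rightarrow> int \<Rightarrow> bool" where
  "diff_seq s = (\<lambda>j. s j \<noteq> s (j + 1))"

lemma diff_seq_shift: "diff_seq (shift k s) = shift k (diff_seq s)"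
  by (simp add: diff_seq_def shift_def ac_simps)

lemma diff_seq_Not: "diff_seq (\<lambda>j. \<not> s j) = diff_seq s"
  by (auto simp: diff_seq_def)

lemma continuous_on_diff_seq: "continuous_on S diff_seq"
proof -
  have "continuous_on S (\<lambda>s::int \<Rightarrow> bool. s j \<noteq> s (j + 1))" for j
    unfolding continuous_on_def tendsto_discrete
  proof
    fix y :: "int \<Rightarrow> bool" assume "y \<in> S"
    have "\<forall>\<^sub>F s in at y within S. s k = y k" for k
      using continuous_on_product_then_coordinatewise[OF continuous_on_id, of S k] \<open>y \<in> S\<close>
      by (simp add: continuous_on_def tendsto_discrete)
    from this[of j] this[of "j + 1"]
    show "\<forall>\<^sub>F s in at y within S. (s j \<noteq> s (j + 1)) = (y j \<noteq> y (j + 1))"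
      by eventually_elim simp
  qed
  then show ?thesis
    unfolding diff_seq_def[abs_def] by (rule continuous_on_coordinatewise_then_product)
qed

text \<open>A preimage is a primitive modulo 2: the parity of the number of true entries of
  \<open>y\<close> between 0 and \<open>j\<close>. The sets \<open>A j\<close> and
  \<open>B j\<close> count to the right and to the left of 0, and one of them is always
  empty.\<close>

lemma surj_diff_seq: "surj diff_seq"
proof (rule surjI)
  fix y :: "int \<Rightarrow> bool"
  define A B where "A j = {k\<in>{0..<j}. y k}" and "B j = {k\<in>{j..<0}. y k}" for j
  let ?s = "\<lambda>j. odd (card (A j) + card (B j))"
  have fin: "finite (A j)" "finite (B j)" for j
    by (rule finite_subset[of _ "{0..<j}"], auto simp: A_def)
      (rule finite_subset[of _ "{j..<0}"], auto simp: B_def)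
  show "diff_seq ?s = y"
  proof
    fix j :: int
    show "diff_seq ?s j = y j"
    proof (cases "j \<ge> 0")
      case True
      then have "B j = {}" "B (j + 1) = {}" by (auto simp: B_def)
      moreover have "{0..<j + 1} = insert j {0..<j}" using True by auto
      then have "A (j + 1) = (if y j then insert j (A j) else A j)" by (auto simp: A_def)
      moreover have "j \<notin> A j" by (simp add: A_def)
      ultimately show ?thesis using fin by (simp add: diff_seq_def)
    next
      case False
      then have "A j = {}" "A (j + 1) = {}" by (auto simp: A_def)
      moreover have "{j..<0} = insert j {j + 1..<0}" using False by auto
      then have "B j = (if y j then insert j (B (j + 1)) else B (j + 1))" by (auto simp: B_def)
      moreover have "j \<notin> B (j + 1)" by (simp add: B_def)
      ultimately show ?thesis using fin by (simp add: diff_seq_def)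
    qed
  qed
qed

subsection \<open>Shifts built from a homeomorphism and a functional\<close>

text \<open>\<open>L\<close> may lie in \<open>K\<close> or not. If it does, \<open>\<phi>\<close>
  and the weight must extend continuously from the sequence, where \<open>e (n + 1)\<close> goes to
  \<open>e n\<close> with weight 1; hence \<open>L\<close> is fixed and
  \<open>w L = 1\<close>.\<close>

locale shift_space =
  fixes K :: "'a::heine_borel set" and e :: "nat \<Rightarrow> 'a" and L :: 'a
    and \<kappa> \<kappa>' :: "'a \<Rightarrow> 'a" and w :: "'a \<Rightarrow> 'k::real_normed_field"
  assumes compact_K: "compact K"
    and inj_e: "inj e" and e_lim: "e \<longlonglongrightarrow> L"
    and e_neq_L [simp]: "e n \<noteq> L" and e_notin_K [simp]: "e n \<notin> K"
    and homeo_K: "homeomorphism K K \<kappa> \<kappa>'"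
    and \<kappa>_L: "L \<in> K \<Longrightarrow> \<kappa> L = L"
    and cont_w: "continuous_on K w"
    and norm_w: "x \<in> K \<Longrightarrow> norm (w x) = 1"
    and w_L: "L \<in> K \<Longrightarrow> w L = 1"
begin

definition X where "X = K \<union> insert L (range e)"

text \<open>Since \<open>0 - 1 = 0\<close> in the naturals, \<open>e 0\<close> is sent to itself.
  This value lies outside the domain \<open>X - {e 0}\<close> of the homeomorphism, but keeps the
  map continuous on all of \<open>X\<close>.\<close>

definition \<phi> where
  "\<phi> x = (if x \<in> K then \<kappa> x else if x = L then L else e (inv e x - 1))"

definition \<psi> where
  "\<psi> x = (if x \<in> K then \<kappa>' x else if x = L then L else e (Suc (inv e x)))"

definition a where "a x = (if x \<in> K then w x else 1)"

text \<open>The left inverse of the shift \<open>T\<close> to come. It does not involve the value at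
  \<open>e 0\<close>, so it is available before the functional is chosen.\<close>

definition R :: "('a \<Rightarrow> 'k) \<Rightarrow> 'a \<Rightarrow> 'k" where
  "R f y = (if y \<in> X then f (\<psi> y) / a (\<psi> y) else 0)"

lemma L_neq_e [simp]: "L \<noteq> e n"
  using e_neq_L[of n] by (rule not_sym)

lemma X_cases [consumes 1, case_names core limit seq]:
  assumes "x \<in> X"
  obtains "x \<in> K" | "x = L" | n where "x = e n"
  using assms by (auto simp: X_def)

lemma K_in_X: "x \<in> K \<Longrightarrow> x \<in> X" and L_in_X [simp]: "L \<in> X" and e_in_X [simp]: "e n \<in> X"
  by (auto simp: X_def)

lemma e_eq_iff [simp]: "e m = e n \<longleftrightarrow> m = n"
  using inj_e by (auto dest: injD)

lemma inv_e [simp]: "inv e (e n) = n"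
  using inj_e by simp

lemma \<kappa>_simps:
  assumes "x \<in> K" shows "\<kappa> x \<in> K" "\<kappa>' x \<in> K" "\<kappa> (\<kappa>' x) = x" "\<kappa>' (\<kappa> x) = x"
  using homeo_K assms unfolding homeomorphism_def by blast+

lemma \<phi>_K [simp]: "x \<in> K \<Longrightarrow> \<phi> x = \<kappa> x" and \<psi>_K [simp]: "x \<in> K \<Longrightarrow> \<psi> x = \<kappa>' x"
  and a_K [simp]: "x \<in> K \<Longrightarrow> a x = w x"
  by (simp_all add: \<phi>_def \<psi>_def a_def)

lemma \<phi>_L [simp]: "\<phi> L = L" and \<psi>_L [simp]: "\<psi> L = L" and a_L [simp]: "a L = 1"
  using \<kappa>_L \<kappa>_simps(4)[of L] w_L by (auto simp: \<phi>_def \<psi>_def a_def)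

lemma \<phi>_e: "\<phi> (e n) = e (n - 1)" and \<psi>_e [simp]: "\<psi> (e n) = e (Suc n)" and a_e [simp]: "a (e n) = 1"
  by (simp_all add: \<phi>_def \<psi>_def a_def)

lemma \<psi>_in_X: "y \<in> X \<Longrightarrow> \<psi> y \<in> X - {e 0}"
proof (cases rule: X_cases)
  assume "y \<in> K"
  then have "\<kappa>' y \<in> K" by (rule \<kappa>_simps)
  moreover from this have "\<kappa>' y \<noteq> e 0" by (metis e_notin_K)
  ultimately show ?thesis using \<open>y \<in> K\<close> by (simp add: X_def)
qed auto

lemma \<phi>_in_X: "x \<in> X \<Longrightarrow> \<phi> x \<in> X"
  by (cases rule: X_cases) (auto simp: X_def \<kappa>_simps \<phi>_e)

lemma \<phi>_\<psi>: "y \<in> X \<Longrightarrow> \<phi> (\<psi> y) = y"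
  by (cases rule: X_cases) (auto simp: \<kappa>_simps \<phi>_e)

lemma \<psi>_\<phi>: "x \<in> X - {e 0} \<Longrightarrow> \<psi> (\<phi> x) = x"
proof -
  assume "x \<in> X - {e 0}"
  then have "x \<in> X" "x \<noteq> e 0" by auto
  then show ?thesis
    by (cases rule: X_cases) (auto simp: \<kappa>_simps \<phi>_e)
qed

lemma norm_a: "norm (a x) = 1"
  by (simp add: a_def norm_w)

lemma a_nonzero [simp]: "a x \<noteq> 0"
  using norm_a[of x] by auto

lemma compact_seq: "compact (insert L (e ` {N..}))"
proof -
  have "e ` {N..} = range (\<lambda>n. e (n + N))"
    by (auto simp: image_iff) (metis le_Suc_ex add.commute)
  then show ?thesis
    using compact_sequence_with_limit[OF LIMSEQ_ignore_initial_segment[OF e_lim]] by simp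
qed

lemma range_e_split: "range e = e ` {..<N} \<union> e ` {N..}"
proof -
  have "UNIV = {..<N} \<union> {N..}" by auto
  then show ?thesis by (metis image_Un)
qed

lemma compact_X: "compact X"
  unfolding X_def using compact_Un[OF compact_K compact_seq[of 0]] by (simp add: atLeast_0)

text \<open>The other points of \<open>X\<close> form a closed set: \<open>K\<close>, finitely many
  terms, and a tail together with its limit.\<close>

lemma isolated_e: "e n isolated_in X"
proof -
  have "closed (K \<union> (e ` {..<n} \<union> insert L (e ` {Suc n..})))"
    using compact_K compact_seq[of "Suc n"]
    by (intro closed_Un[OF compact_imp_closed closed_Un[OF finite_imp_closed compact_imp_closed]]) auto
  moreover have "- (K \<union> (e ` {..<n} \<union> insert L (e ` {Suc n..}))) \<inter> X = {e n}"
    unfolding X_def using range_e_split[of "Suc n"] by (auto simp: lessThan_Suc)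
  ultimately show ?thesis
    unfolding isolated_in_def by (metis e_in_X open_Compl)
qed

lemma continuous_on_seq:
  assumes "(\<lambda>n. f (e n)) \<longlonglongrightarrow> f L"
  shows "continuous_on (insert L (range e)) f"
  unfolding continuous_on_def
proof
  fix x assume x: "x \<in> insert L (range e)"
  show "(f \<longlongrightarrow> f x) (at x within insert L (range e))"
  proof (cases "x = L")
    case True
    show ?thesis
    proof (rule topological_tendstoI)
      fix B assume "open B" "f x \<in> B"
      then obtain N where N: "\<And>n. n \<ge> N \<Longrightarrow> f (e n) \<in> B"
        using assms True unfolding tendsto_def eventually_sequentially by blast
      have "open (- e ` {..<N})" by (intro open_Compl finite_imp_closed) auto
      moreover have "f y \<in> B" if "y \<in> - e ` {..<N}" "y \<in> insert L (range e)" for y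
        using that N \<open>f x \<in> B\<close> True range_e_split[of N] by auto
      ultimately show "\<forall>\<^sub>F y in at x within insert L (range e). f y \<in> B"
        unfolding eventually_at_topological using True by (intro exI[of _ "- e ` {..<N}"]) auto
    qed
  next
    case False
    with x obtain n where "x = e n" by auto
    then have "\<not> x islimpt X" using isolated_e[of n] by (simp add: isolated_in_islimpt_iff)
    then have "\<not> x islimpt insert L (range e)" using islimpt_subset by (metis X_def Un_upper2)
    then have "at x within insert L (range e) = bot" by (simp add: trivial_limit_within)
    then show ?thesis by simp
  qed
qed

text \<open>Gluing over the closed pieces \<open>K\<close> and \<open>insert L (range e)\<close>. On
  the second piece only continuity at \<open>L\<close> has content.\<close>

lemma continuous_on_X:
  assumes "continuous_on K f" "(\<lambda>n. f (e n)) \<longlonglongrightarrow> f L"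
  shows "continuous_on X f"
  unfolding X_def
  using compact_K compact_seq[of 0] assms
  by (intro continuous_on_closed_Un continuous_on_seq compact_imp_closed) (simp_all add: atLeast_0)

lemma cont_funs_lim: "f \<in> cont_funs X \<Longrightarrow> (\<lambda>n. f (e n)) \<longlonglongrightarrow> f L"
  unfolding cont_funs_def by (auto intro!: continuous_on_tendsto_compose[of X f] e_lim)

lemma cont_funs_K: "f \<in> cont_funs X \<Longrightarrow> continuous_on K f"
  unfolding cont_funs_def X_def by (auto elim: continuous_on_subset)

lemma cont_funs_outside: "f \<in> cont_funs X \<Longrightarrow> x \<notin> X \<Longrightarrow> f x = 0"
  by (simp add: cont_funs_def)

lemma cont_funs_const_on_X: "(\<lambda>x. if x \<in> X then c else 0) \<in> cont_funs X"
proof -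
  have "continuous_on X (\<lambda>x. if x \<in> X then c else 0)"
    by (rule continuous_on_eq[of _ "\<lambda>_. c"]) auto
  then show ?thesis by (simp add: cont_funs_def)
qed

lemma homeomorphism_\<phi>: "homeomorphism (X - {e 0}) X \<phi> \<psi>"
proof (rule homeomorphismI)
  have cont: "continuous_on K \<kappa>" "continuous_on K \<kappa>'"
    using homeo_K by (auto simp: homeomorphism_def)
  have "(\<lambda>n. e (n - 1)) \<longlonglongrightarrow> L"
    by (rule LIMSEQ_offset[of _ 1]) (simp add: e_lim)
  then have "continuous_on X \<phi>"
    by (intro continuous_on_X continuous_on_eq[OF cont(1)]) (simp_all add: \<phi>_e)
  then show "continuous_on (X - {e 0}) \<phi>"
    by (rule continuous_on_subset) auto
  show "continuous_on X \<psi>"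
    by (intro continuous_on_X continuous_on_eq[OF cont(2)]) (simp_all add: LIMSEQ_Suc e_lim)
qed (use \<psi>_in_X \<phi>_in_X \<phi>_\<psi> \<psi>_\<phi> in auto)

lemma continuous_on_a: "continuous_on X a"
  by (intro continuous_on_X continuous_on_eq[OF cont_w]) simp_all

lemma R_in_cont_funs:
  assumes "f \<in> cont_funs X" shows "R f \<in> cont_funs X"
proof -
  have "continuous_on X \<psi>" "\<psi> ` X \<subseteq> X" "continuous_on X f"
    using homeomorphism_\<phi> assms by (auto simp: homeomorphism_def cont_funs_def)
  then have "continuous_on X (\<lambda>y. f (\<psi> y) / a (\<psi> y))"
    by (intro continuous_on_divide continuous_on_compose2[of X f X \<psi>]
        continuous_on_compose2[OF continuous_on_a, of X \<psi>]) auto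
  then have "continuous_on X (R f)"
    by (rule continuous_on_eq) (simp add: R_def)
  then show ?thesis by (simp add: cont_funs_def R_def)
qed

lemma R_K: "x \<in> K \<Longrightarrow> R f x = f (\<kappa>' x) / w (\<kappa>' x)"
  by (simp add: R_def K_in_X \<kappa>_simps)

lemma R_iter_e: "(R ^^ n) f (e m) = f (e (m + n))"
  by (induction n arbitrary: m) (simp_all add: R_def)

lemma inv_into_\<phi>_e: "(inv_into (X - {e 0}) \<phi> ^^ n) (e 0) = e n"
proof (induction n)
  case (Suc n)
  have "inj_on \<phi> (X - {e 0})" using \<psi>_\<phi> by (rule inj_on_inverseI)
  then have "inv_into (X - {e 0}) \<phi> (e n) = e (Suc n)"
    by (rule inv_into_f_eq) (simp_all add: \<phi>_e)
  with Suc show ?case by simp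
qed simp

lemma shift_points_eq: "shift_points X (e 0) \<phi> = range e"
  by (simp add: shift_points_def inv_into_\<phi>_e)

lemma closure_shift_points: "closure (shift_points X (e 0) \<phi>) = insert L (range e)"
proof
  show "closure (shift_points X (e 0) \<phi>) \<subseteq> insert L (range e)"
    unfolding shift_points_eq using compact_seq[of 0]
    by (intro closure_minimal compact_imp_closed) (auto simp: atLeast_0)
  have "L \<in> closure (range e)"
    unfolding closure_sequential using e_lim by auto
  then show "insert L (range e) \<subseteq> closure (shift_points X (e 0) \<phi>)"
    unfolding shift_points_eq using closure_subset[of "range e"] by blast
qed

lemma core_set_eq: "core_set X (e 0) \<phi> = K - {L}"
  unfolding core_set_def closure_shift_points by (auto simp: X_def)

end

section \<open>The shift determined by a functional\<close>

locale shift_functional = shift_space K e L \<kappa> \<kappa>' w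
  for K :: "'a::heine_borel set" and e L \<kappa> \<kappa>' and w :: "'a \<Rightarrow> 'k::real_normed_field" +
  fixes \<Lambda> :: "('a \<Rightarrow> 'k) \<Rightarrow> 'k"
  assumes \<Lambda>_add: "f \<in> cont_funs X \<Longrightarrow> g \<in> cont_funs X \<Longrightarrow> \<Lambda> (\<lambda>x. f x + g x) = \<Lambda> f + \<Lambda> g"
    and \<Lambda>_scale: "f \<in> cont_funs X \<Longrightarrow> \<Lambda> (\<lambda>x. c * f x) = c * \<Lambda> f"
    and \<Lambda>_support: "(\<And>x. x \<in> K \<Longrightarrow> f x = 0) \<Longrightarrow> \<Lambda> f = 0"
    and \<Lambda>_bound: "f \<in> cont_funs X \<Longrightarrow> (\<And>x. x \<in> X \<Longrightarrow> norm (f x) \<le> B) \<Longrightarrow> norm (\<Lambda> f) \<le> B / 2"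
    and \<Lambda>_separating:
      "f \<in> cont_funs X \<Longrightarrow> (\<lambda>n. \<Lambda> ((R ^^ n) f)) \<longlonglongrightarrow> f L \<Longrightarrow> x \<in> K \<Longrightarrow> f x = 0"
begin

text \<open>The functional fills the one value that the weighted composition leaves open.\<close>

definition T :: "('a \<Rightarrow> 'k) \<Rightarrow> 'a \<Rightarrow> 'k" where
  "T f x = (if x = e 0 then \<Lambda> f else if x \<in> X then a x * f (\<phi> x) else 0)"

lemma T_off: "x \<in> X - {e 0} \<Longrightarrow> T f x = a x * f (\<phi> x)"
  by (simp add: T_def)

lemma T_in_cont_funs:
  assumes f: "f \<in> cont_funs X" shows "T f \<in> cont_funs X"
proof -
  have "continuous_on K \<kappa>" "\<kappa> ` K \<subseteq> K"
    using homeo_K by (auto simp: homeomorphism_def)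
  then have "continuous_on K (\<lambda>x. w x * f (\<kappa> x))"
    by (intro continuous_on_mult cont_w continuous_on_compose2[OF cont_funs_K[OF f]]) auto
  then have "continuous_on K (T f)"
    by (rule continuous_on_eq) (auto simp: T_def K_in_X)
  moreover have "(\<lambda>n. T f (e n)) \<longlonglongrightarrow> T f L"
    \<comment> \<open>The first index is dropped because \<open>T f\<close> at \<open>e 0\<close> is
      given by the functional.\<close>
    by (rule LIMSEQ_offset[of _ 1]) (use cont_funs_lim[OF f] e_neq_L[of 0] in \<open>auto simp: T_def \<phi>_e\<close>)
  ultimately have "continuous_on X (T f)" by (rule continuous_on_X)
  then show ?thesis by (auto simp: cont_funs_def T_def)
qed

lemma R_T: "f \<in> cont_funs X \<Longrightarrow> R (T f) = f"
proof
  fix y assume f: "f \<in> cont_funs X"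
  show "R (T f) y = f y"
  proof (cases "y \<in> X")
    case True
    then show ?thesis using \<psi>_in_X[OF True] by (simp add: R_def T_off \<phi>_\<psi>)
  qed (simp add: R_def cont_funs_outside[OF f])
qed

lemma T_R: "f \<in> cont_funs X \<Longrightarrow> x \<noteq> e 0 \<Longrightarrow> T (R f) x = f x"
  by (cases "x \<in> X") (auto simp: T_def R_def \<psi>_\<phi> \<phi>_in_X cont_funs_outside)

lemma norm_le_sup_norm: "f \<in> cont_funs X \<Longrightarrow> x \<in> X \<Longrightarrow> norm (f x) \<le> sup_norm X f"
proof -
  assume f: "f \<in> cont_funs X" and x: "x \<in> X"
  have "bdd_above ((\<lambda>x. norm (f x)) ` X)"
    using f compact_X unfolding cont_funs_def
    by (intro bounded_imp_bdd_above compact_imp_bounded compact_continuous_image continuous_on_norm) auto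
  then show ?thesis unfolding sup_norm_def using x by (rule cSUP_upper[rotated])
qed

lemma sup_norm_le: "(\<And>x. x \<in> X \<Longrightarrow> norm (f x) \<le> B) \<Longrightarrow> sup_norm X f \<le> B"
  unfolding sup_norm_def using L_in_X by (intro cSUP_least) blast+

text \<open>The value at \<open>e 0\<close> is at most half the norm of \<open>f\<close>, and
  \<open>\<phi>\<close> is already onto \<open>X\<close> off \<open>e 0\<close>, so every value of
  \<open>norm (f y)\<close> reappears.\<close>

lemma sup_norm_T:
  assumes f: "f \<in> cont_funs X" shows "sup_norm X (T f) = sup_norm X f"
proof (rule antisym)
  show "sup_norm X (T f) \<le> sup_norm X f"
  proof (rule sup_norm_le)
    fix x assume x: "x \<in> X"
    have "norm (\<Lambda> f) \<le> sup_norm X f / 2"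
      by (rule \<Lambda>_bound[OF f norm_le_sup_norm[OF f]])
    moreover have "0 \<le> sup_norm X f"
      using norm_le_sup_norm[OF f L_in_X] norm_ge_zero[of "f L"] by linarith
    ultimately show "norm (T f x) \<le> sup_norm X f"
      using x norm_le_sup_norm[OF f \<phi>_in_X[OF x]] by (simp add: T_def norm_mult norm_a)
  qed
  show "sup_norm X f \<le> sup_norm X (T f)"
  proof (rule sup_norm_le)
    fix y assume y: "y \<in> X"
    have "norm (f y) = norm (T f (\<psi> y))"
      using \<psi>_in_X[OF y] by (simp add: T_off \<phi>_\<psi>[OF y] norm_mult norm_a)
    also have "\<dots> \<le> sup_norm X (T f)"
      using \<psi>_in_X[OF y] by (intro norm_le_sup_norm T_in_cont_funs f) auto
    finally show "norm (f y) \<le> sup_norm X (T f)" .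
  qed
qed

lemma linear_isometry_T: "linear_isometry X T"
  unfolding linear_isometry_def
  using T_in_cont_funs sup_norm_T
  by (auto simp: T_def fun_eq_iff \<Lambda>_add \<Lambda>_scale algebra_simps)

text \<open>The quotient is spanned by the indicator of \<open>e 0\<close>, since \<open>f\<close>
  and \<open>T (R f)\<close> agree elsewhere. The indicator is not in the range: its only candidate
  preimage \<open>R ?g\<close> vanishes on \<open>K\<close>, so the functional gives 0 at
  \<open>e 0\<close> instead of 1.\<close>

lemma codim_one_range_T: "codim_one X (T ` cont_funs X)"
  unfolding codim_one_def
proof (intro conjI bexI ballI)
  let ?g = "\<lambda>x. if x = e 0 then 1 else 0 :: 'k"
  show "T ` cont_funs X \<subseteq> cont_funs X" using T_in_cont_funs by auto
  have "continuous_on K ?g"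
    by (rule continuous_on_eq[of _ "\<lambda>_. 0"]) auto
  moreover have "(\<lambda>n. ?g (e n)) \<longlonglongrightarrow> ?g L"
    by (rule LIMSEQ_offset[of _ 1]) (use e_neq_L[of 0] in auto)
  ultimately have "continuous_on X ?g" by (rule continuous_on_X)
  then show "?g \<in> cont_funs X" by (auto simp: cont_funs_def)
  show "?g \<notin> T ` cont_funs X"
  proof
    assume "?g \<in> T ` cont_funs X"
    then obtain f where f: "f \<in> cont_funs X" "?g = T f" by blast
    have "R ?g x = 0" if "x \<in> K" for x
      using that \<kappa>_simps(2)[OF that] by (auto simp: R_K)
    moreover have "R ?g = f" using f R_T by simp
    ultimately have "\<Lambda> f = 0" by (intro \<Lambda>_support) simp
    moreover have "T f (e 0) = 1" using fun_cong[OF f(2), of "e 0"] by simp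
    ultimately show False by (simp add: T_def)
  qed
  show "\<exists>c. (\<lambda>x. f x - c * ?g x) \<in> T ` cont_funs X" if f: "f \<in> cont_funs X" for f
  proof (intro exI image_eqI)
    show "R f \<in> cont_funs X" using f by (rule R_in_cont_funs)
    show "(\<lambda>x. f x - (f (e 0) - \<Lambda> (R f)) * ?g x) = T (R f)"
      using T_R[OF f] by (auto simp: fun_eq_iff T_def[of _ "e 0"])
  qed
qed

text \<open>A function in every range is reconstructed along the orbit of \<^term>\<open>e 0\<close> from its values on
  \<^term>\<open>K\<close>: its value at \<^term>\<open>e n\<close> is \<^term>\<open>\<Lambda>\<close> of a backward iterate, so continuity at
  \<^term>\<open>L\<close> forces the sequence of these numbers to converge.\<close>
lemma Inter_range_T: "(\<Inter>n\<in>{1..}. (T ^^ n) ` cont_funs X) = {\<lambda>x. 0}"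
proof -
  have T_iter: "(T ^^ n) f \<in> cont_funs X" if "f \<in> cont_funs X" for f n
    using that by (induction n) (auto intro: T_in_cont_funs)
  have R_T_iter: "(R ^^ n) ((T ^^ n) f) = f" if "f \<in> cont_funs X" for f n
  proof (induction n)
    case (Suc n)
    have "(R ^^ Suc n) ((T ^^ Suc n) f) = (R ^^ n) (R (T ((T ^^ n) f)))"
      by (simp only: funpow_Suc_right o_apply funpow_swap1[of T])
    also have "\<dots> = f" using R_T[OF T_iter[OF that]] Suc by simp
    finally show ?case .
  qed simp
  have "f = (\<lambda>x. 0)" if f: "f \<in> (\<Inter>n\<in>{1..}. (T ^^ n) ` cont_funs X)" for f
  proof -
    \<comment> \<open>Membership in the range of the power \<open>Suc n\<close> leaves
      \<open>(R ^^ n) f\<close> in the range of \<open>T\<close>; evaluating it at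
      \<open>e 0\<close> gives the functional.\<close>
    have "(R ^^ n) f = T ((R ^^ Suc n) f)" for n
    proof -
      obtain g where g: "g \<in> cont_funs X" "f = (T ^^ Suc n) g" using f by (auto dest: bspec[of _ _ "Suc n"] simp del: funpow.simps)
      have "(R ^^ Suc n) f = g" using R_T_iter[OF g(1), of "Suc n"] g(2) by simp
      moreover have "(R ^^ n) f = T g"
        using R_T_iter[OF T_in_cont_funs[OF g(1)], of n] g(2) by (simp add: funpow_swap1)
      ultimately show ?thesis by simp
    qed
    then have val: "f (e n) = \<Lambda> ((R ^^ Suc n) f)" for n
      by (metis R_iter_e T_def add_0)
    have fX: "f \<in> cont_funs X" using INT_D[OF f, of 1] T_in_cont_funs by auto
    have "(\<lambda>n. \<Lambda> ((R ^^ Suc n) f)) \<longlonglongrightarrow> f L"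
      using cont_funs_lim[OF fX] by (simp only: val)
    then have lim: "(\<lambda>n. \<Lambda> ((R ^^ n) f)) \<longlonglongrightarrow> f L"
      by (subst (asm) filterlim_sequentially_Suc)
    have K0: "f x = 0" if "x \<in> K" for x
      using \<Lambda>_separating[OF fX lim that] .
    have "(R ^^ n) f x = 0" if "x \<in> K" for n x
      using that by (induction n arbitrary: x) (simp_all add: K0 R_K \<kappa>_simps)
    then have e0: "f (e n) = 0" for n by (simp only: val \<Lambda>_support)
    then have "f L = 0"
      using cont_funs_lim[OF fX] LIMSEQ_unique[of "\<lambda>n. 0"] by auto
    then have "f x = 0" for x
      using K0 e0 cont_funs_outside[OF fX] by (cases "x \<in> X") (auto simp: X_def)
    then show ?thesis by auto
  qed
  moreover have "(\<lambda>x. 0) \<in> (T ^^ n) ` cont_funs X" for n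
  proof (rule image_eqI)
    have "T (\<lambda>x. 0) = (\<lambda>x. 0)" using \<Lambda>_support[of "\<lambda>x. 0"] by (auto simp: T_def fun_eq_iff)
    then show "(\<lambda>x. 0) = (T ^^ n) (\<lambda>x. 0)" by (induction n) simp_all
  qed (simp add: cont_funs_def)
  ultimately show ?thesis by blast
qed

lemma isometric_shift_T: "isometric_shift X T"
  unfolding isometric_shift_def
  using linear_isometry_T codim_one_range_T Inter_range_T by blast

lemma type_I_rep_T: "type_I_rep X T (e 0) \<phi> a"
  unfolding type_I_rep_def
  using isolated_e homeomorphism_\<phi> norm_a T_off continuous_on_subset[OF continuous_on_a]
  by blast

text \<open>Tested on the constant 1: type II would give modulus 1 at \<open>e 0\<close>, while the
  functional gives at most 1/2.\<close>

lemma not_type_II_T: "\<not> type_II X T"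
proof
  assume "type_II X T"
  then obtain \<phi>' a' where II: "\<phi>' ` X = X" "\<And>x. x \<in> X \<Longrightarrow> norm (a' x) = 1"
    "\<And>f x. f \<in> cont_funs X \<Longrightarrow> x \<in> X \<Longrightarrow> T f x = a' x * f (\<phi>' x)"
    unfolding type_II_def by blast
  let ?f = "\<lambda>x. if x \<in> X then 1 else 0 :: 'k"
  have "\<phi>' (e 0) \<in> X" using II(1) e_in_X by blast
  then have "\<Lambda> ?f = a' (e 0)"
    using II(3)[OF cont_funs_const_on_X e_in_X[of 0], of 1] by (simp add: T_def)
  moreover have "norm (\<Lambda> ?f) \<le> 1 / 2"
    by (rule \<Lambda>_bound[OF cont_funs_const_on_X]) simp
  ultimately show False using II(2)[OF e_in_X[of 0]] by simp
qed

lemma type_I0_T: "type_I0 X T"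
  unfolding type_I0_def type_I_def using type_I_rep_T not_type_II_T by blast

end

subsection \<open>Shifts on fibrations of the Cantor set\<close>

text \<open>The given sequence may repeat terms or meet \<open>L\<close>. Any injective enumeration
  of its other values converges to \<open>L\<close>, as only finitely many values lie outside a
  given neighbourhood.\<close>

lemma convergent_enumeration:
  fixes x :: "nat \<Rightarrow> 'a::metric_space"
  assumes "infinite (range x)" "x \<longlonglongrightarrow> L"
  obtains e :: "nat \<Rightarrow> 'a" where "inj e" "range e = range x - {L}" "e \<longlonglongrightarrow> L"
proof -
  let ?E = "range x - {L}"
  define e where "e = from_nat_into ?E"
  have "bij_betw e UNIV ?E"
    unfolding e_def using assms(1) by (intro bij_betw_from_nat_into) auto
  then have e: "inj e" "range e = ?E" by (auto simp: bij_betw_def)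
  have "e \<longlonglongrightarrow> L"
  proof (rule tendstoI)
    fix \<epsilon> :: real assume "\<epsilon> > 0"
    then obtain N where N: "\<And>n. n \<ge> N \<Longrightarrow> dist (x n) L < \<epsilon>"
      using tendstoD[OF assms(2)] unfolding eventually_sequentially by blast
    have "e ` {n. \<not> dist (e n) L < \<epsilon>} \<subseteq> x ` {..<N}"
    proof
      fix y assume y: "y \<in> e ` {n. \<not> dist (e n) L < \<epsilon>}"
      then have "y \<in> range e" by blast
      then obtain m where "y = x m" unfolding e(2) by blast
      moreover have "m < N" using N[of m] y \<open>y = x m\<close> by (auto simp: not_le[symmetric])
      ultimately show "y \<in> x ` {..<N}" by blast
    qed
    then have "finite (e ` {n. \<not> dist (e n) L < \<epsilon>})" by (rule finite_subset) simp
    then have "finite {n. \<not> dist (e n) L < \<epsilon>}"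
      using e(1) by (metis finite_imageD inj_on_subset subset_UNIV)
    then show "\<forall>\<^sub>F n in sequentially. dist (e n) L < \<epsilon>"
      unfolding cofinite_eq_sequentially[symmetric] eventually_cofinite .
  qed
  with e show ?thesis by (rule that)
qed

section \<open>Fibred coding, signs and the orbit sum\<close>

definition sgn_bit :: "bool \<Rightarrow> 'k::real_normed_field" where
  "sgn_bit b = (if b then -1 else 1)"

lemma norm_sgn_bit [simp]: "norm (sgn_bit b) = 1"
  by (simp add: sgn_bit_def)

text \<open>\<open>G\<close> identifies a compact set of reals with \<open>U\<close> times the full
  two-sided shift. The sequence \<open>u\<close> is dense in \<open>U\<close> and may repeat, which
  allows \<open>U\<close> to be finite.\<close>

locale fibration =
  fixes U :: "'u::topological_space set" and u :: "nat \<Rightarrow> 'u"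
    and G :: "'u \<times> (int \<Rightarrow> bool) \<Rightarrow> real" and s :: "nat \<Rightarrow> int \<Rightarrow> bool"
  assumes compact_U: "compact U" and U_eq: "U = closure (range u)"
    and cont_G: "continuous_on (U \<times> UNIV) G" and inj_G: "inj_on G (U \<times> UNIV)"
    and generic_s: "generic s"
begin

abbreviation K where "K \<equiv> G ` (U \<times> UNIV)"

definition coord where "coord = the_inv_into (U \<times> UNIV) G"
definition shift_K where "shift_K k x = (let (v, y) = coord x in G (v, shift k y))"
definition weight :: "real \<Rightarrow> 'k::real_normed_field" where
  "weight x = sgn_bit (snd (coord x) 0)"

lemma norm_weight [simp]: "norm (weight x) = 1"
  by (simp add: weight_def)

text \<open>Flipping all bits of \<open>t\<close> preserves \<open>diff_seq t\<close> and changes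
  the sign bit, so this is an odd function of \<open>t\<close>.\<close>

definition odd_lift :: "(real \<Rightarrow> 'k::real_normed_field) \<Rightarrow> 'u \<Rightarrow> (int \<Rightarrow> bool) \<Rightarrow> 'k" where
  "odd_lift f v t = sgn_bit (t 0) * f (G (v, diff_seq t))"

text \<open>The coefficients add up to 1/2, the norm bound required of the functional.\<close>

definition orbit_sum :: "(real \<Rightarrow> 'k::{real_normed_field, banach}) \<Rightarrow> (nat \<Rightarrow> int \<Rightarrow> bool) \<Rightarrow> 'k" where
  "orbit_sum f Z = (\<Sum>i. (1 / 2) ^ (i + 2) * odd_lift f (u i) (Z i))"

lemma generic_subsequence:
  obtains n where "filterlim n at_top sequentially"
    "\<And>i. (\<lambda>r. shift (- int (n r)) (s i)) \<longlonglongrightarrow> Z i"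
  using generic_s unfolding generic_def by blast

lemma u_in_U [simp]: "u i \<in> U"
  unfolding U_eq by (rule subsetD[OF closure_subset]) simp

lemma coord_G [simp]: "v \<in> U \<Longrightarrow> coord (G (v, y)) = (v, y)"
  unfolding coord_def by (rule the_inv_into_f_f[OF inj_G]) simp

lemma G_in_K [simp]: "v \<in> U \<Longrightarrow> G (v, y) \<in> K"
  by blast

lemma shift_K_G [simp]: "v \<in> U \<Longrightarrow> shift_K k (G (v, y)) = G (v, shift k y)"
  by (simp add: shift_K_def)

lemma compact_fibers: "F \<subseteq> U \<Longrightarrow> compact F \<Longrightarrow> compact (G ` (F \<times> UNIV))"
  by (intro compact_continuous_image continuous_on_subset[OF cont_G] compact_Times compact_UNIV_bool_fun) auto

lemma compact_K: "compact K"
  using compact_U by (intro compact_fibers) simp_all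

lemma continuous_on_coord: "continuous_on K coord"
  unfolding coord_def
  by (intro continuous_on_inv_into cont_G inj_G compact_Times compact_U compact_UNIV_bool_fun)

lemma continuous_on_shift_K: "continuous_on K (shift_K k)"
proof -
  have "continuous_on K (\<lambda>x. G (fst (coord x), shift k (snd (coord x))))"
    by (rule continuous_on_compose2[OF cont_G])
      (auto intro!: continuous_on_Pair continuous_on_shift continuous_on_fst continuous_on_snd
        continuous_on_coord)
  then show ?thesis
    by (rule continuous_on_eq) (simp add: shift_K_def split_beta)
qed

lemma homeomorphism_shift_K: "homeomorphism K K (shift_K 1) (shift_K (- 1))"
  by (rule homeomorphismI) (use continuous_on_shift_K in auto)

lemma continuous_on_weight: "continuous_on K (weight :: real \<Rightarrow> 'k::real_normed_field)"
proof -
  have "continuous_on UNIV (\<lambda>b::int \<Rightarrow> bool. sgn_bit (b 0) :: 'k)"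
    by (rule continuous_on_of_coordinate)
  then show ?thesis
    unfolding weight_def[abs_def]
    by (rule continuous_on_compose2) (auto intro: continuous_on_snd continuous_on_coord)
qed

lemma continuous_on_odd_lift:
  assumes f: "continuous_on K f" and v: "v \<in> U"
  shows "continuous_on S (odd_lift f v)"
proof -
  have "continuous_on S (\<lambda>t. G (v, diff_seq t))"
    using v by (intro continuous_on_compose2[OF cont_G] continuous_on_Pair continuous_on_const
        continuous_on_diff_seq) auto
  then have "continuous_on S (\<lambda>t. f (G (v, diff_seq t)))"
    using v by (intro continuous_on_compose2[OF f]) auto
  then show ?thesis
    unfolding odd_lift_def[abs_def]
    by (intro continuous_on_mult continuous_on_of_coordinate)
qed

lemma bounded_on_K:
  assumes "continuous_on K (f :: real \<Rightarrow> 'k::real_normed_field)"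
  obtains B where "\<And>x. x \<in> K \<Longrightarrow> norm (f x) \<le> B"
proof -
  have "bounded (f ` K)"
    by (intro compact_imp_bounded compact_continuous_image assms compact_fibers compact_U order_refl)
  then show ?thesis using that unfolding bounded_iff by blast
qed

lemma orbit_sum_term_le:
  assumes "\<And>x. x \<in> K \<Longrightarrow> norm (f x) \<le> B"
  shows "norm ((1 / 2) ^ (i + 2) * odd_lift f (u i) t) \<le> B / 4 * (1 / 2) ^ i"
proof -
  have "norm ((1 / 2) ^ (i + 2) * odd_lift f (u i) t) = (1 / 2) ^ (i + 2) * norm (f (G (u i, diff_seq t)))"
    by (simp add: odd_lift_def norm_mult norm_power norm_divide)
  also have "\<dots> \<le> (1 / 2) ^ (i + 2) * B"
    by (intro mult_left_mono assms) auto
  finally show ?thesis by (simp add: power_add mult.commute)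
qed

lemma summable_half: "summable (\<lambda>i. B / 4 * (1 / 2 :: real) ^ i)"
  by (intro summable_mult summable_geometric) simp

lemma summable_orbit_sum:
  assumes "continuous_on K f"
  shows "summable (\<lambda>i. (1 / 2) ^ (i + 2) * odd_lift f (u i) (Z i) :: 'k::{real_normed_field, banach})"
proof -
  obtain B where "\<And>x. x \<in> K \<Longrightarrow> norm (f x) \<le> B" using bounded_on_K[OF assms] by blast
  then show ?thesis by (rule summable_comparison_test'[OF summable_half orbit_sum_term_le])
qed

lemma orbit_sum_scale:
  assumes "continuous_on K f"
  shows "orbit_sum (\<lambda>x. c * f x) Z = c * orbit_sum f Z"
proof -
  have "(1 / 2) ^ (i + 2) * odd_lift (\<lambda>x. c * f x) (u i) (Z i)
    = c * ((1 / 2) ^ (i + 2) * odd_lift f (u i) (Z i))" for i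
    by (simp only: odd_lift_def mult.left_commute[of _ c])
  then show ?thesis
    unfolding orbit_sum_def by (simp only: suminf_mult[OF summable_orbit_sum[OF assms]])
qed

lemma orbit_sum_add:
  assumes "continuous_on K f" "continuous_on K g"
  shows "orbit_sum (\<lambda>x. f x + g x) Z = orbit_sum f Z + orbit_sum g Z"
proof -
  have "(1 / 2) ^ (i + 2) * odd_lift (\<lambda>x. f x + g x) (u i) (Z i)
    = (1 / 2) ^ (i + 2) * odd_lift f (u i) (Z i) + (1 / 2) ^ (i + 2) * odd_lift g (u i) (Z i)" for i
    by (simp only: odd_lift_def distrib_left)
  then show ?thesis
    unfolding orbit_sum_def
    by (simp only: suminf_add[OF summable_orbit_sum[OF assms(1)] summable_orbit_sum[OF assms(2)]])
qed

lemma norm_orbit_sum_le: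
  assumes "\<And>x. x \<in> K \<Longrightarrow> norm (f x) \<le> B"
  shows "norm (orbit_sum f Z) \<le> B / 2"
proof -
  have "norm (orbit_sum f Z) \<le> (\<Sum>i. B / 4 * (1 / 2) ^ i)"
    unfolding orbit_sum_def by (intro norm_suminf_le orbit_sum_term_le summable_half assms)
  also have "\<dots> = B / 2"
    using suminf_mult[OF summable_geometric[of "1 / 2 :: real"], of "B / 4"]
    by (simp add: suminf_geometric)
  finally show ?thesis .
qed

lemma continuous_on_orbit_sum:
  fixes f :: "real \<Rightarrow> 'k::{real_normed_field, banach}"
  assumes f: "continuous_on K f"
  shows "continuous_on S (orbit_sum f)"
proof -
  obtain B where B: "\<And>x. x \<in> K \<Longrightarrow> norm (f x) \<le> B" using bounded_on_K[OF f] by blast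
  have "continuous_on S (\<lambda>Z::nat \<Rightarrow> int \<Rightarrow> bool. Z i)" for i
    using continuous_on_product_then_coordinatewise[OF continuous_on_id, of S i] by simp
  then have "continuous_on S (\<lambda>Z::nat \<Rightarrow> int \<Rightarrow> bool. odd_lift f (u i) (Z i))" for i
    by (intro continuous_on_compose2[OF continuous_on_odd_lift[OF f u_in_U, of UNIV]]) auto
  then have "continuous_on S (\<lambda>Z. \<Sum>i. (1 / 2) ^ (i + 2) * odd_lift f (u i) (Z i))"
    by (intro continuous_on_suminf[OF _ orbit_sum_term_le[OF B] summable_half] continuous_on_mult_left) auto
  then show ?thesis unfolding orbit_sum_def[abs_def] .
qed

text \<open>For fixed \<open>y\<close>, the value is continuous in the fibre index, and the indices
  \<open>u i\<close> are dense in \<open>U\<close>.\<close>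

lemma vanishes_on_K:
  fixes f :: "real \<Rightarrow> 'k::real_normed_field"
  assumes f: "continuous_on K f" and zero: "\<And>i y. f (G (u i, y)) = 0" and x: "x \<in> K"
  shows "f x = 0"
proof -
  obtain v y where v: "v \<in> U" "x = G (v, y)" using x by blast
  have "continuous_on U (\<lambda>v. G (v, y))"
    by (rule continuous_on_compose2[OF cont_G]) (auto intro!: continuous_on_Pair)
  then have "continuous_on U (\<lambda>v. f (G (v, y)))"
    by (rule continuous_on_compose2[OF f]) auto
  then show ?thesis
    using v zero unfolding U_eq
    by (auto intro: continuous_constant_on_closure[of "range u" "\<lambda>v. f (G (v, y))"])
qed

text \<open>If the sums along the backward orbits of \<^term>\<open>s\<close> converge, then by genericity
  \<^term>\<open>orbit_sum f\<close> is constant; changing the sign of a single argument isolates a single summand.\<close>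
lemma orbit_sum_separating:
  fixes f :: "real \<Rightarrow> 'k::{real_normed_field, banach}"
  assumes f: "continuous_on K f" and x: "x \<in> K"
    and lim: "(\<lambda>n. orbit_sum f (\<lambda>i. shift (- int n) (s i))) \<longlonglongrightarrow> l"
  shows "f x = 0"
proof -
  have const: "orbit_sum f Z = l" for Z
  proof -
    obtain n where n: "filterlim n at_top sequentially" "\<And>i. (\<lambda>r. shift (- int (n r)) (s i)) \<longlonglongrightarrow> Z i"
      using generic_subsequence by blast
    have "(\<lambda>r i. shift (- int (n r)) (s i)) \<longlonglongrightarrow> Z"
      using n(2) by (rule tendsto_coordinatewise)
    then have "(\<lambda>r. orbit_sum f (\<lambda>i. shift (- int (n r)) (s i))) \<longlonglongrightarrow> orbit_sum f Z"
      by (intro continuous_on_tendsto_compose[OF continuous_on_orbit_sum[OF f, of UNIV]]) auto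
    moreover have "(\<lambda>r. orbit_sum f (\<lambda>i. shift (- int (n r)) (s i))) \<longlonglongrightarrow> l"
      using filterlim_compose[OF lim n(1)] .
    ultimately show ?thesis by (rule LIMSEQ_unique)
  qed
  have "f (G (u i, y)) = 0" for i y
  proof -
    obtain t where t: "y = diff_seq t" using surj_diff_seq by (metis surjD)
    define Z Z' where "Z = (\<lambda>_::nat. t)" and "Z' = Z(i := \<lambda>j. \<not> t j)"
    let ?h = "\<lambda>Z k. (1 / 2) ^ (k + 2) * odd_lift f (u k) (Z k) :: 'k"
    have "(\<lambda>k. ?h Z k - ?h Z' k) sums (orbit_sum f Z - orbit_sum f Z')"
      unfolding orbit_sum_def by (intro sums_diff summable_sums summable_orbit_sum f)
    moreover have "(\<lambda>k. ?h Z k - ?h Z' k) = (\<lambda>k. if k = i then ?h Z i - ?h Z' i else 0)"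
      by (auto simp: Z'_def)
    ultimately have "(\<lambda>k. if k = i then ?h Z i - ?h Z' i else 0) sums 0"
      by (simp add: const)
    then have "?h Z i - ?h Z' i = 0"
      using sums_single[of i "\<lambda>_. ?h Z i - ?h Z' i"] sums_unique2 by blast
    moreover have "odd_lift f (u i) (Z' i) = - odd_lift f (u i) (Z i)"
      by (simp add: odd_lift_def Z_def Z'_def diff_seq_Not sgn_bit_def)
    ultimately have "odd_lift f (u i) (Z i) = 0"
      by (simp add: algebra_simps)
    then show ?thesis by (auto simp: odd_lift_def Z_def t sgn_bit_def split: if_splits)
  qed
  with f show ?thesis using x by (rule vanishes_on_K)
qed

text \<open>The weight at the shifted point is the product of the signs of \<open>t (- 1)\<close>
  and \<open>t 0\<close>. Dividing by it replaces the sign of \<open>t 0\<close> by that of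
  \<open>t (- 1)\<close>, so the twisted operator acts on lifts as a plain shift.\<close>

lemma odd_lift_shift:
  fixes g :: "real \<Rightarrow> 'k::real_normed_field"
  assumes "v \<in> U"
  shows "sgn_bit (t 0) * (g (shift_K (- 1) (G (v, diff_seq t))) / weight (shift_K (- 1) (G (v, diff_seq t))))
    = odd_lift g v (shift (- 1) t)"
proof -
  have sgn: "sgn_bit b * (c / sgn_bit (a \<noteq> b)) = sgn_bit a * c" for a b and c :: 'k
    by (cases a; cases b) (simp_all add: sgn_bit_def)
  have "snd (coord (G (v, shift (- 1) (diff_seq t)))) 0 = (shift (- 1) t 0 \<noteq> t 0)"
    using assms by (simp add: shift_def diff_seq_def)
  then show ?thesis
    unfolding odd_lift_def weight_def shift_K_G[OF assms] diff_seq_shift by (simp only: sgn)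
qed

section \<open>Orbits in the fibres and the number of generators\<close>

lemma dense_backward_orbit:
  assumes v: "v \<in> U" and y: "\<And>n. G (v, shift (- int n) (s 0)) \<in> S"
  shows "G (v, y) \<in> closure S"
proof -
  obtain n where n: "\<And>i::nat. (\<lambda>r. shift (- int (n r)) (s i)) \<longlonglongrightarrow> y"
    using generic_subsequence[of "\<lambda>_. y"] by blast
  have "(\<lambda>r. G (v, shift (- int (n r)) (s 0))) \<longlonglongrightarrow> G (v, y)"
    using v by (intro continuous_on_tendsto_compose[OF cont_G] tendsto_Pair tendsto_const n) auto
  with y show ?thesis
    unfolding closure_sequential by (intro exI[of _ "\<lambda>r. G (v, shift (- int (n r)) (s 0))"]) simp
qed

lemma int_iter_G:
  assumes \<phi>: "\<And>x. x \<in> K \<Longrightarrow> \<phi> x = shift_K 1 x" and v: "v \<in> U"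
  shows "int_iter K \<phi> k (G (v, y)) = G (v, shift k y)"
proof (cases "k \<ge> 0")
  case True
  have "(\<phi> ^^ n) (G (v, y)) = G (v, shift (int n) y)" for n
    using v by (induction n) (simp_all add: \<phi> add.commute)
  with True show ?thesis by (simp add: int_iter_def)
next
  case False
  have "inj_on \<phi> K"
    using homeomorphism_apply1[OF homeomorphism_shift_K]
    by (intro inj_on_inverseI[of _ "shift_K (- 1)"]) (simp only: \<phi>)
  then have "inv_into K \<phi> (G (v, y)) = G (v, shift (- 1) y)" for y
    using v by (intro inv_into_f_eq) (simp_all add: \<phi>)
  then have "(inv_into K \<phi> ^^ n) (G (v, y)) = G (v, shift (- int n) y)" for n
    by (induction n) (simp_all add: algebra_simps)
  with False show ?thesis by (simp add: int_iter_def)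
qed

text \<open>One point with generic second coordinate is taken in each fibre; its backward orbit is
  dense there.\<close>

lemma has_generators_card:
  assumes Y: "core_set X p \<phi> = K" and \<phi>: "\<And>x. x \<in> K \<Longrightarrow> \<phi> x = shift_K 1 x" and fin: "finite U"
  shows "has_generators X p \<phi> (card U)"
proof -
  obtain h where h: "bij_betw h {1..card U} U"
    using ex_bij_betw_nat_finite_1[OF fin] by blast
  let ?x = "\<lambda>i. G (h i, s 0)"
  have hU: "h i \<in> U" if "i \<in> {1..card U}" for i
    using h that by (auto simp: bij_betw_def)
  have "K \<subseteq> closure {int_iter K \<phi> k (?x i) |k i. i \<in> {1..card U}}"
  proof
    fix x assume "x \<in> K"
    then obtain v y where v: "v \<in> U" "x = G (v, y)" by blast
    have "v \<in> h ` {1..card U}" using v(1) bij_betw_imp_surj_on[OF h] by simp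
    then obtain i where i: "i \<in> {1..card U}" "h i = v" by blast
    have "G (v, shift (- int n) (s 0)) = int_iter K \<phi> (- int n) (?x i)" for n
      using int_iter_G[OF \<phi> v(1)] i(2) by simp
    then show "x \<in> closure {int_iter K \<phi> k (?x i) |k i. i \<in> {1..card U}}"
      unfolding v(2) using v(1) i(1) by (intro dense_backward_orbit) blast+
  qed
  with hU show ?thesis
    unfolding has_generators_def Y Let_def by (intro exI[of _ ?x]) auto
qed

text \<open>Orbits stay in their fibres, and finitely many fibres form a closed set. Hence the
  fibres met by the generators are all fibres; for infinite \<open>U\<close> no finite number
  suffices.\<close>

lemma has_generators_ge_card:
  assumes Y: "core_set X p \<phi> = K" and \<phi>: "\<And>x. x \<in> K \<Longrightarrow> \<phi> x = shift_K 1 x"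
    and gen: "has_generators X p \<phi> m"
  shows "finite U" "card U \<le> m"
proof -
  obtain x where x: "\<And>i. i \<in> {1..m} \<Longrightarrow> x i \<in> K"
    and dense: "K \<subseteq> closure {int_iter K \<phi> k (x i) |k i. i \<in> {1..m}}"
    using gen unfolding has_generators_def Y Let_def by blast
  define F where "F = (fst \<circ> coord \<circ> x) ` {1..m}"
  have "x i \<in> G ` (F \<times> UNIV) \<and> (fst \<circ> coord \<circ> x) i \<in> U" if "i \<in> {1..m}" for i
    using x[OF that] that by (force simp: F_def)
  then have FU: "F \<subseteq> U" and xF: "\<And>i. i \<in> {1..m} \<Longrightarrow> x i \<in> G ` (F \<times> UNIV)"
    unfolding F_def by blast+
  have finF: "finite F" by (simp add: F_def)
  have "{int_iter K \<phi> k (x i) |k i. i \<in> {1..m}} \<subseteq> G ` (F \<times> UNIV)"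
  proof clarify
    fix k i assume "i \<in> {1..m}"
    from xF[OF this] obtain v y where vy: "v \<in> F" "x i = G (v, y)" by blast
    then show "int_iter K \<phi> k (x i) \<in> G ` (F \<times> UNIV)"
      using int_iter_G[OF \<phi>, of v] FU by auto
  qed
  then have "closure {int_iter K \<phi> k (x i) |k i. i \<in> {1..m}} \<subseteq> G ` (F \<times> UNIV)"
    by (intro closure_minimal compact_imp_closed compact_fibers FU finite_imp_compact finF)
  with dense have "K \<subseteq> G ` (F \<times> UNIV)" by (rule order_trans)
  have "U \<subseteq> F"
  proof
    fix v assume v: "v \<in> U"
    then have "G (v, s 0) \<in> G ` (F \<times> UNIV)" using \<open>K \<subseteq> G ` (F \<times> UNIV)\<close> by blast
    then obtain v' y' where "v' \<in> F" "G (v, s 0) = G (v', y')" by blast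
    then have "(v, s 0) = (v', y')" using v FU by (intro inj_onD[OF inj_G]) auto
    then show "v \<in> F" using \<open>v' \<in> F\<close> by simp
  qed
  then show "finite U" using finF by (rule finite_subset)
  have "card U \<le> card F" using finF \<open>U \<subseteq> F\<close> by (rule card_mono)
  also have "\<dots> \<le> m" unfolding F_def using card_image_le[of "{1..m}"] by simp
  finally show "card U \<le> m" .
qed

lemma least_generators_iff:
  assumes "core_set X p \<phi> = K" "\<And>x. x \<in> K \<Longrightarrow> \<phi> x = shift_K 1 x"
  shows "least_generators X p \<phi> m \<longleftrightarrow> finite U \<and> card U = m"
  unfolding least_generators_def
  using has_generators_card[of X p \<phi>] has_generators_ge_card[of X p \<phi>] assms
  by (metis le_neq_implies_less not_le)

section \<open>Existence of the two kinds of shifts\<close>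

lemma shift_exists_weighted:
  fixes e :: "nat \<Rightarrow> real"
  assumes e: "inj e" "e \<longlonglongrightarrow> L" "\<And>n. e n \<noteq> L" "\<And>n. e n \<notin> K" and L: "L \<notin> K"
    and X: "X = K \<union> insert L (range e)"
    and N: "case N of enat m \<Rightarrow> finite U \<and> card U = m | \<infinity> \<Rightarrow> infinite U"
  shows "\<exists>T :: (real \<Rightarrow> 'k::{real_normed_field, banach}) \<Rightarrow> (real \<Rightarrow> 'k).
    isometric_shift X T \<and> type_I0 X T \<and> shift_generated X T N"
proof -
  interpret sh: shift_space K e L "shift_K 1" "shift_K (- 1)" "weight :: real \<Rightarrow> 'k"
    by unfold_locales (simp_all only: e L compact_K homeomorphism_shift_K continuous_on_weight norm_weight simp_thms)
  have X': "sh.X = X" by (simp add: sh.X_def X)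
  let ?\<Lambda> = "\<lambda>f :: real \<Rightarrow> 'k. orbit_sum f s"
  have lift_R: "odd_lift (sh.R f) v t = odd_lift f v (shift (- 1) t)" if "v \<in> U" for f v t
    unfolding odd_lift_shift[OF that, symmetric] odd_lift_def[of "sh.R f"] sh.R_K[OF G_in_K[OF that]] ..
  \<comment> \<open>Iterating \<open>R\<close> moves every \<open>s i\<close> backwards by
    \<open>n\<close>, which is the situation of \<open>orbit_sum_separating\<close>.\<close>
  have "odd_lift ((sh.R ^^ n) f) v t = odd_lift f v (shift (- int n) t)" if "v \<in> U" for f v t n
    by (induction n arbitrary: t) (simp_all add: lift_R that algebra_simps)
  then have iter: "?\<Lambda> ((sh.R ^^ n) f) = orbit_sum f (\<lambda>i. shift (- int n) (s i))" for n f
    by (simp add: orbit_sum_def)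
  interpret sf: shift_functional K e L "shift_K 1" "shift_K (- 1)" "weight :: real \<Rightarrow> 'k" ?\<Lambda>
  proof
    fix f g :: "real \<Rightarrow> 'k" and c B x
    assume f: "f \<in> cont_funs sh.X"
    note fK = sh.cont_funs_K[OF f]
    show "?\<Lambda> (\<lambda>x. c * f x) = c * ?\<Lambda> f"
      using fK by (rule orbit_sum_scale)
    show "?\<Lambda> (\<lambda>x. f x + g x) = ?\<Lambda> f + ?\<Lambda> g" if "g \<in> cont_funs sh.X"
      using fK sh.cont_funs_K[OF that] by (rule orbit_sum_add)
    show "norm (?\<Lambda> f) \<le> B / 2" if "\<And>x. x \<in> sh.X \<Longrightarrow> norm (f x) \<le> B"
      using that by (intro norm_orbit_sum_le) (simp add: sh.K_in_X)
    show "f x = 0" if "(\<lambda>n. ?\<Lambda> ((sh.R ^^ n) f)) \<longlonglongrightarrow> f L" "x \<in> K"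
      using orbit_sum_separating[OF fK that(2)] that(1) unfolding iter .
  next
    fix f :: "real \<Rightarrow> 'k" assume "\<And>x. x \<in> K \<Longrightarrow> f x = 0"
    then show "?\<Lambda> f = 0" by (simp add: orbit_sum_def odd_lift_def)
  qed
  have core: "core_set X (e 0) sh.\<phi> = K"
    using sh.core_set_eq L by (simp add: X')
  have "x \<notin> insert L (range e)" if x: "x \<in> K" for x
  proof (intro notI, elim insertE rangeE)
    assume "x = L"
    with x L show False by (simp only:)
  next
    fix n assume "x = e n"
    with x e(4)[of n] show False by (simp only:)
  qed
  from this[OF G_in_K[OF u_in_U]] have "\<not> X \<subseteq> closure (shift_points X (e 0) sh.\<phi>)"
    using sh.closure_shift_points sh.K_in_X[OF G_in_K[OF u_in_U]] unfolding X' by (metis subsetD)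
  moreover have "least_generators X (e 0) sh.\<phi> m \<longleftrightarrow> finite U \<and> card U = m" for m
    by (rule least_generators_iff[OF core sh.\<phi>_K])
  ultimately have "shift_generated X sf.T N"
    unfolding shift_generated_def using sf.type_I_rep_T N
    by (intro exI[of _ "e 0"] exI[of _ sh.\<phi>] exI[of _ sh.a]) (auto simp: X' split: enat.splits)
  then show ?thesis
    using sf.isometric_shift_T sf.type_I0_T unfolding X' by blast
qed

lemma shift_exists_unweighted:
  fixes e :: "nat \<Rightarrow> real"
  assumes e: "inj e" "e \<longlonglongrightarrow> L" "\<And>n. e n \<noteq> L" "\<And>n. e n \<notin> K"
    and X: "X = K \<union> insert L (range e)"
    and U: "U = {u 0}" and L: "L = G (u 0, \<lambda>_. False)"
  shows "\<exists>T :: (real \<Rightarrow> 'k::real_normed_field) \<Rightarrow> (real \<Rightarrow> 'k).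
    isometric_shift X T \<and> type_I0 X T \<and>
    (\<exists>p \<phi> a. type_I_rep X T p \<phi> a \<and> (\<forall>y\<in>X - {p}. a y = 1))"
proof -
  \<comment> \<open>\<open>L\<close> is coded by a constant sequence, a fixed point of the
    shift.\<close>
  have "shift_K 1 L = L"
    unfolding L by (simp add: shift_def)
  then interpret sh: shift_space K e L "shift_K 1" "shift_K (- 1)" "\<lambda>_. 1 :: 'k"
    by unfold_locales (simp_all only: e compact_K homeomorphism_shift_K continuous_on_const norm_one simp_thms)
  have X': "sh.X = X" by (simp add: sh.X_def X)
  let ?\<Lambda> = "\<lambda>f :: real \<Rightarrow> 'k. f (G (u 0, s 0)) / 2"
  have R: "sh.R f (G (u 0, y)) = f (G (u 0, shift (- 1) y))" for f y
    by (simp add: sh.R_K)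
  have iter: "(sh.R ^^ n) f (G (u 0, y)) = f (G (u 0, shift (- int n) y))" for n f y
    by (induction n arbitrary: y) (simp_all add: R algebra_simps)
  interpret sf: shift_functional K e L "shift_K 1" "shift_K (- 1)" "\<lambda>_. 1 :: 'k" ?\<Lambda>
  proof
    fix f g :: "real \<Rightarrow> 'k" and c B x
    assume f: "f \<in> cont_funs sh.X"
    note fK = sh.cont_funs_K[OF f]
    show "?\<Lambda> (\<lambda>x. c * f x) = c * ?\<Lambda> f" by simp
    show "?\<Lambda> (\<lambda>x. f x + g x) = ?\<Lambda> f + ?\<Lambda> g" by (simp add: add_divide_distrib)
    show "norm (?\<Lambda> f) \<le> B / 2" if "\<And>x. x \<in> sh.X \<Longrightarrow> norm (f x) \<le> B"
      using that[OF sh.K_in_X[OF G_in_K[of "u 0" "s 0"]]] by (simp add: norm_divide)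
    show "f x = 0" if lim: "(\<lambda>n. ?\<Lambda> ((sh.R ^^ n) f)) \<longlonglongrightarrow> f L" and x: "x \<in> K"
    proof -
      have half: "f (G (u 0, y)) / 2 = f L" for y
      proof -
        obtain n where n: "filterlim n at_top sequentially" "\<And>i::nat. (\<lambda>r. shift (- int (n r)) (s i)) \<longlonglongrightarrow> y"
          using generic_subsequence[of "\<lambda>_. y"] by blast
        have "(\<lambda>r. G (u 0, shift (- int (n r)) (s 0))) \<longlonglongrightarrow> G (u 0, y)"
          by (intro continuous_on_tendsto_compose[OF cont_G] tendsto_Pair tendsto_const n) auto
        then have "(\<lambda>r. f (G (u 0, shift (- int (n r)) (s 0)))) \<longlonglongrightarrow> f (G (u 0, y))"
          by (intro continuous_on_tendsto_compose[OF fK]) auto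
        then have "(\<lambda>r. f (G (u 0, shift (- int (n r)) (s 0))) / 2) \<longlonglongrightarrow> f (G (u 0, y)) / 2"
          by (intro tendsto_divide tendsto_const) auto
        moreover have "(\<lambda>r. f (G (u 0, shift (- int (n r)) (s 0))) / 2) \<longlonglongrightarrow> f L"
          using filterlim_compose[OF lim n(1)] by (simp add: iter)
        ultimately show ?thesis by (rule LIMSEQ_unique)
      qed
      \<comment> \<open>Taking \<open>y\<close> to be the code of \<open>L\<close> gives
        \<open>f L / 2 = f L\<close>; here \<open>L\<close> in \<open>K\<close> is
        essential.\<close>
      have "f L = 0" using half[of "\<lambda>_. False"] by (simp add: L[symmetric])
      then show "f x = 0" using half x unfolding U by auto
    qed
  next
    fix f :: "real \<Rightarrow> 'k" assume "\<And>x. x \<in> K \<Longrightarrow> f x = 0"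
    then show "?\<Lambda> f = 0" by simp
  qed
  have "sh.a x = 1" for x by (simp add: sh.a_def)
  then show ?thesis
    using sf.isometric_shift_T sf.type_I0_T sf.type_I_rep_T unfolding X' by blast
qed

end

section \<open>Concrete fibrations of the Cantor set\<close>

lemma continuous_on_reindex: "continuous_on S (\<lambda>y::'a \<Rightarrow> 'c::topological_space. y \<circ> h)"
proof -
  have "continuous_on S (\<lambda>y::'a \<Rightarrow> 'c. y j)" for j
    using continuous_on_product_then_coordinatewise[OF continuous_on_id, of S j] by simp
  then show ?thesis
    by (intro continuous_on_coordinatewise_then_product) simp
qed

text \<open>Two-sided sequences are reindexed by the naturals through \<open>int_decode\<close>. It
  then suffices to split the space of one-sided sequences as a product of \<open>U\<close> with
  itself.\<close>

lemma fibration_of_coding: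
  fixes H :: "'u::topological_space \<times> (nat \<Rightarrow> bool) \<Rightarrow> nat \<Rightarrow> bool"
  assumes "compact U" "U = closure (range u)" "generic s"
    and cont: "continuous_on (U \<times> UNIV) H" and bij: "bij_betw H (U \<times> UNIV) UNIV"
  defines "G \<equiv> \<lambda>(v, y). cantor_map (H (v, y \<circ> int_decode))"
  shows "fibration U u G s" "G ` (U \<times> UNIV) = cantor_set"
proof -
  let ?\<rho> = "\<lambda>(v :: 'u, y :: int \<Rightarrow> bool). (v, y \<circ> int_decode)"
  have G: "G = cantor_map \<circ> H \<circ> ?\<rho>" by (auto simp: G_def)
  have "y = (y \<circ> int_encode) \<circ> int_decode" for y :: "nat \<Rightarrow> bool" by auto
  then have im: "?\<rho> ` (U \<times> UNIV) = U \<times> UNIV" by (force simp: image_iff)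
  have inj: "inj_on ?\<rho> (U \<times> UNIV)"
    using surj_int_decode by (auto simp: inj_on_def surj_fun_eq)
  have "continuous_on (U \<times> UNIV) ?\<rho>"
    unfolding split_beta
    by (intro continuous_on_Pair continuous_on_fst continuous_on_id
        continuous_on_compose2[OF continuous_on_reindex[of UNIV] continuous_on_snd]) auto
  then have "continuous_on (U \<times> UNIV) G"
    unfolding G using cont im by (intro continuous_on_compose continuous_on_cantor_map) auto
  moreover have "inj_on G (U \<times> UNIV)"
    unfolding G using inj bij im inj_cantor_map
    by (intro comp_inj_on) (auto simp: bij_betw_def intro: inj_on_subset)
  ultimately show "fibration U u G s"
    using assms(1-3) by (intro fibration.intro)
  show "G ` (U \<times> UNIV) = cantor_set"
    using bij im by (simp only: G image_comp[symmetric] bij_betw_def range_cantor_map)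
qed

text \<open>A prefix code cutting sequence space into \<open>n + 1\<close> clopen copies of itself:
  for \<open>i > 0\<close> the prefix is \<open>n - i\<close> times false and then true, and for
  \<open>i = 0\<close> it is \<open>n\<close> times false.\<close>

primrec piece :: "nat \<Rightarrow> nat \<Rightarrow> (nat \<Rightarrow> bool) \<Rightarrow> nat \<Rightarrow> bool" where
  "piece 0 i z = z"
| "piece (Suc n) i z = case_nat (i = Suc n) (if i = Suc n then z else piece n i z)"

lemma case_nat_inject: "case_nat a f = case_nat b g \<longleftrightarrow> a = b \<and> f = g"
  by (metis ext nat.case)

lemma piece_inject: "i \<le> n \<Longrightarrow> i' \<le> n \<Longrightarrow> piece n i z = piece n i' z' \<Longrightarrow> i = i' \<and> z = z'"
  by (induction n) (auto simp: case_nat_inject le_Suc_eq split: if_splits)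

lemma piece_surj: "\<exists>i\<le>n. \<exists>z. piece n i z = b"
proof (induction n arbitrary: b)
  case (Suc n)
  have b: "b = case_nat (b 0) (\<lambda>m. b (Suc m))" by (rule ext) (simp split: nat.split)
  show ?case
  proof (cases "b 0")
    case True
    then have "piece (Suc n) (Suc n) (\<lambda>m. b (Suc m)) = b" using b by simp
    then show ?thesis by blast
  next
    case False
    obtain i z where "i \<le> n" "piece n i z = (\<lambda>m. b (Suc m))" using Suc by blast
    then have "piece (Suc n) i z = b" using b False by simp
    then show ?thesis using \<open>i \<le> n\<close> le_SucI by blast
  qed
qed simp

lemma continuous_on_piece: "continuous_on S (piece n i)"
proof (induction n)
  case 0
  then show ?case by (simp add: continuous_on_id[unfolded id_def])
next
  case (Suc n)
  have id: "continuous_on S (\<lambda>z::nat \<Rightarrow> bool. z)" by (rule continuous_on_id)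
  have "continuous_on S (\<lambda>z. if i = Suc n then z else piece n i z)"
    using Suc id by (cases "i = Suc n") auto
  from continuous_on_product_then_coordinatewise[OF this]
  have "continuous_on S (\<lambda>z. piece (Suc n) i z m)" for m
    by (cases m) simp_all
  then show ?case by (rule continuous_on_coordinatewise_then_product)
qed

lemma continuous_on_discrete_Times:
  fixes f :: "'a::discrete_topology \<times> 'b::topological_space \<Rightarrow> 'c::topological_space"
  assumes "\<And>v. v \<in> U \<Longrightarrow> continuous_on UNIV (\<lambda>z. f (v, z))"
  shows "continuous_on (U \<times> UNIV) f"
proof -
  have "continuous_on ({v} \<times> UNIV) f" if "v \<in> U" for v
  proof (rule continuous_on_eq)
    show "continuous_on ({v} \<times> UNIV) (\<lambda>p. f (v, snd p))"
      by (rule continuous_on_compose2[OF assms[OF that]]) (auto intro: continuous_on_snd continuous_on_id)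
  qed auto
  then have "continuous_on (\<Union>v\<in>U. {v} \<times> UNIV) f"
    by (intro continuous_on_open_UN open_Times open_discrete open_UNIV)
  then show ?thesis by (simp add: UN_Times_distrib[symmetric] Sigma_def)
qed

lemma finite_fibration:
  assumes "generic s"
  obtains G where "fibration {..n::nat} (\<lambda>i. min i n) G s" "G ` ({..n} \<times> UNIV) = cantor_set"
proof -
  have "k \<in> range (\<lambda>i. min i n)" if "k \<le> n" for k
    using that by (intro range_eqI[of _ _ k]) simp
  then have "range (\<lambda>i. min i n) = {..n}" by auto
  moreover have "closed {..n}" by (simp add: closed_def open_discrete)
  ultimately have cl: "{..n} = closure (range (\<lambda>i. min i n))" by simp
  have comp: "compact {..n}" by (intro finite_imp_compact) simp
  have cont: "continuous_on ({..n} \<times> UNIV) (\<lambda>(i, z). piece n i z)"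
    by (intro continuous_on_discrete_Times) (simp add: continuous_on_piece)
  have bij: "bij_betw (\<lambda>(i, z). piece n i z) ({..n} \<times> UNIV) UNIV"
  proof (rule bij_betw_imageI)
    show "inj_on (\<lambda>(i, z). piece n i z) ({..n} \<times> UNIV)"
      by (auto intro!: inj_onI dest: piece_inject[rotated 2])
    have "b \<in> (\<lambda>(i, z). piece n i z) ` ({..n} \<times> UNIV)" for b
    proof -
      obtain i z where "i \<le> n" "piece n i z = b" using piece_surj by blast
      then show ?thesis by (intro image_eqI[of _ _ "(i, z)"]) auto
    qed
    then show "(\<lambda>(i, z). piece n i z) ` ({..n} \<times> UNIV) = UNIV" by blast
  qed
  from fibration_of_coding[OF comp cl assms cont bij] show ?thesis by (rule that)
qed

lemma infinite_fibration:
  assumes s: "generic s"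
  obtains u G where "fibration (UNIV :: (nat \<Rightarrow> bool) set) u G s" "G ` (UNIV \<times> UNIV) = cantor_set"
proof -
  \<comment> \<open>The nonnegative halves of the backward shifts of a generic sequence are dense
    among one-sided sequences.\<close>
  define u where "u n = shift (- int n) (s 0) \<circ> int" for n
  have "v \<in> closure (range u)" for v :: "nat \<Rightarrow> bool"
  proof -
    obtain n where n: "\<And>i::nat. (\<lambda>r. shift (- int (n r)) (s i)) \<longlonglongrightarrow> (v \<circ> nat)"
      using s[unfolded generic_def, rule_format, of "\<lambda>_. v \<circ> nat"] by blast
    have "(\<lambda>r. u (n r)) \<longlonglongrightarrow> ((v \<circ> nat) \<circ> int)"
      unfolding u_def by (intro continuous_on_tendsto_compose[OF continuous_on_reindex[of UNIV]] n) auto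
    moreover have "(v \<circ> nat) \<circ> int = v" by (rule ext) simp
    moreover have "\<forall>\<^sub>F r in sequentially. u (n r) \<in> closure (range u)"
      using closure_subset[of "range u"] by (intro always_eventually) auto
    ultimately show ?thesis
      using Lim_in_closed_set[of "closure (range u)"] by force
  qed
  then have cl: "UNIV = closure (range u)" by blast
  \<comment> \<open>Interleaving: the even digits give the fibre, the odd digits the point in
    it.\<close>
  let ?H = "\<lambda>(v :: nat \<Rightarrow> bool, z) m. if even m then v (m div 2) else z (m div 2)"
  have cont: "continuous_on (UNIV \<times> UNIV) ?H"
  proof (rule continuous_on_coordinatewise_then_product)
    fix m :: nat
    have "continuous_on (UNIV \<times> UNIV) (\<lambda>p :: (nat \<Rightarrow> bool) \<times> (nat \<Rightarrow> bool). fst p (m div 2))"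
      "continuous_on (UNIV \<times> UNIV) (\<lambda>p :: (nat \<Rightarrow> bool) \<times> (nat \<Rightarrow> bool). snd p (m div 2))"
      by (rule continuous_on_product_then_coordinatewise, intro continuous_on_fst continuous_on_snd continuous_on_id)+
    then show "continuous_on (UNIV \<times> UNIV) (\<lambda>p. ?H p m)"
      by (cases "even m") (simp_all add: split_beta)
  qed
  have bij: "bij_betw ?H (UNIV \<times> UNIV) UNIV"
  proof (rule bij_betw_byWitness[where f' = "\<lambda>b. (\<lambda>m. b (2 * m), \<lambda>m. b (Suc (2 * m)))"])
    show "\<forall>b\<in>UNIV. ?H ((\<lambda>m. b (2 * m), \<lambda>m. b (Suc (2 * m)))) = b"
      by (auto simp: fun_eq_iff elim: evenE oddE)
  qed auto
  from fibration_of_coding[OF compact_UNIV_bool_fun cl s cont bij] show ?thesis by (rule that)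
qed

lemma pointed_fibration:
  assumes s: "generic s" and L: "L \<in> cantor_set"
  obtains G where "fibration {0::nat} (\<lambda>_. 0) G s" "G ` ({0} \<times> UNIV) = cantor_set"
    "G (0, \<lambda>_. False) = L"
proof -
  obtain b where b: "L = cantor_map b" using L range_cantor_map by blast
  \<comment> \<open>Bitwise addition modulo 2 of the code of \<open>L\<close> carries the constant
    false sequence to \<open>L\<close>.\<close>
  let ?H = "\<lambda>(i :: nat, z) m. z m \<noteq> b m"
  have cont: "continuous_on ({0} \<times> UNIV) ?H"
  proof (intro continuous_on_discrete_Times continuous_on_coordinatewise_then_product)
    show "continuous_on UNIV (\<lambda>z. ?H (v, z) m)" for v m
      using continuous_on_of_coordinate[of UNIV "\<lambda>c. c \<noteq> b m" m] by simp
  qed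
  have bij: "bij_betw ?H ({0} \<times> UNIV) UNIV"
    by (rule bij_betw_byWitness[where f' = "\<lambda>c. (0, \<lambda>m. c m \<noteq> b m)"]) auto
  have cl: "{0::nat} = closure (range (\<lambda>_::nat. 0))" by simp
  have "compact {0::nat}" by simp
  from fibration_of_coding[OF this cl s cont bij] show ?thesis
    by (rule that) (simp add: b)
qed

section \<open>The two cases for the limit point\<close>

lemma shift_exists_off_cantor:
  fixes x :: "nat \<Rightarrow> real"
  assumes x: "\<And>n. x n \<notin> cantor_set" "infinite (range x)" "x \<longlonglongrightarrow> L"
    and X: "X = cantor_set \<union> range x \<union> {L}" and L: "L \<notin> cantor_set" and N: "1 \<le> N"
  shows "\<exists>T :: (real \<Rightarrow> 'k::{real_normed_field, banach}) \<Rightarrow> (real \<Rightarrow> 'k).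
    isometric_shift X T \<and> type_I0 X T \<and> shift_generated X T N"
proof -
  obtain e where e: "inj e" "range e = range x - {L}" "e \<longlonglongrightarrow> L"
    using convergent_enumeration[OF x(2,3)] by blast
  have eL: "e n \<noteq> L" and eK: "e n \<notin> cantor_set" for n
    using e(2) x(1) by (metis DiffE rangeE rangeI singletonI)+
  have X': "X = cantor_set \<union> insert L (range e)"
    unfolding X e(2) by auto
  obtain s where s: "generic s" using generic_exists by blast
  show ?thesis
  proof (cases N)
    case (enat m)
    with N have "0 < m" by (simp add: one_enat_def)
    \<comment> \<open>An \<open>m\<close>-generated shift needs exactly \<open>m\<close> fibres;
      \<open>1 \<le> N\<close> excludes \<open>m = 0\<close>.\<close>
    then have m: "card {..m - 1} = m" by simp
    obtain G where G: "fibration {..m - 1} (\<lambda>i. min i (m - 1)) G s" "G ` ({..m - 1} \<times> UNIV) = cantor_set"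
      using s by (rule finite_fibration)
    show ?thesis
      by (rule fibration.shift_exists_weighted[OF G(1), unfolded G(2), OF e(1,3) eL eK L X'])
        (simp only: enat m finite_atMost enat.simps simp_thms)
  next
    case infinity
    obtain u :: "nat \<Rightarrow> nat \<Rightarrow> bool" and G where G: "fibration UNIV u G s" "G ` (UNIV \<times> UNIV) = cantor_set"
      using s by (rule infinite_fibration)
    have "infinite (UNIV :: (nat \<Rightarrow> bool) set)"
      by (rule infinite_super[OF subset_UNIV range_inj_infinite[of "\<lambda>n m. m = n"]])
        (auto simp: inj_def fun_eq_iff)
    then show ?thesis
      by (intro fibration.shift_exists_weighted[OF G(1), unfolded G(2), OF e(1,3) eL eK L X'])
        (simp add: infinity)
  qed
qed

lemma shift_exists_on_cantor:
  fixes x :: "nat \<Rightarrow> real"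
  assumes x: "\<And>n. x n \<notin> cantor_set" "infinite (range x)" "x \<longlonglongrightarrow> L"
    and X: "X = cantor_set \<union> range x \<union> {L}" and L: "L \<in> cantor_set"
  shows "\<exists>T :: (real \<Rightarrow> 'k::real_normed_field) \<Rightarrow> (real \<Rightarrow> 'k).
    isometric_shift X T \<and> type_I0 X T \<and>
    (\<exists>p \<phi> a. type_I_rep X T p \<phi> a \<and> (\<forall>y\<in>X - {p}. a y = 1))"
proof -
  obtain e where e: "inj e" "range e = range x - {L}" "e \<longlonglongrightarrow> L"
    using convergent_enumeration[OF x(2,3)] by blast
  have eL: "e n \<noteq> L" and eK: "e n \<notin> cantor_set" for n
    using e(2) x(1) by (metis DiffE rangeE rangeI singletonI)+
  have X': "X = cantor_set \<union> insert L (range e)"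
    unfolding X e(2) by auto
  obtain s where s: "generic s" using generic_exists by blast
  obtain G where G: "fibration {0::nat} (\<lambda>_. 0) G s" "G ` ({0} \<times> UNIV) = cantor_set" "G (0, \<lambda>_. False) = L"
    using s L by (rule pointed_fibration)
  show ?thesis
    by (rule fibration.shift_exists_unweighted[OF G(1), unfolded G(2), OF e(1,3) eL eK X' refl])
      (simp add: G(3))
qed

theorem theorem4p8:
  fixes x :: "nat \<Rightarrow> real" and L :: real and X :: "real set"
  assumes "\<And>n. x n \<notin> cantor_set"
    and "infinite (range x)"
    and "x \<longlonglongrightarrow> L"
    and "X = cantor_set \<union> range x \<union> {L}"
  shows
    "(L \<notin> cantor_set \<longrightarrow>
       (\<forall>n::enat. 1 \<le> n \<longrightarrow>
         (\<exists>T :: (real \<Rightarrow> real) \<Rightarrow> (real \<Rightarrow> real).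
            isometric_shift X T \<and> type_I0 X T \<and> shift_generated X T n) \<and>
         (\<exists>T :: (real \<Rightarrow> complex) \<Rightarrow> (real \<Rightarrow> complex).
            isometric_shift X T \<and> type_I0 X T \<and> shift_generated X T n)))
     \<and>
     (L \<in> cantor_set \<longrightarrow>
       (\<exists>T :: (real \<Rightarrow> real) \<Rightarrow> (real \<Rightarrow> real).
          isometric_shift X T \<and> type_I0 X T \<and>
          (\<exists>p \<phi> a. type_I_rep X T p \<phi> a \<and> (\<forall>y\<in>X - {p}. a y = 1))) \<and>
       (\<exists>T :: (real \<Rightarrow> complex) \<Rightarrow> (real \<Rightarrow> complex).
          isometric_shift X T \<and> type_I0 X T \<and>
          (\<exists>p \<phi> a. type_I_rep X T p \<phi> a \<and> (\<forall>y\<in>X - {p}. a y = 1))))"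
  by (intro conjI impI allI shift_exists_off_cantor[OF assms] shift_exists_on_cantor[OF assms])

end
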